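(* Consider the problem and Algorithm 2 described in the context (so $R$ is the indicator function of a polytope $P\subset\mathbb R^n$ with binary vertices, and quadratic growth holds). Set $\gamma_i=c_1^{1/2}(1-c_1)^{\frac{i-1}{2}}$, $i\ge1$, in Algorithm 2, where $c_1=\frac{\alpha}{32n^*\tilde\beta D^2}$. Then the sequence of iterates $(y_i)_{i\ge1}$ is feasible (i.e. $y_i\in P$ for all $i$), and for all $i\ge1$, $$\phi_t(y_i)-\phi_t(x^* )\le\max\left\{\frac{\tilde\beta D^2}{2}\left(1-\frac{\alpha}{32n^*\tilde\beta D^2}\right)^{i-1},\ \frac{\beta_2}{3}\|x_t-x^*\|^3\right\}.$$
   Context: Problem: $\min_{x\in\mathbb R^n}F(x)=f(x)+R(x)$, with the standard inner product and Euclidean norm $\|\cdot\|$ (induced operator norm for matrices). $R$ is the indicator function ($0$ on $P$, $+\infty$ outside) of a convex compact polytope $P=\{x\in\mathbb R^n: x\ge0,\ Ax=b\}$ whose set of vertices $\mathcal V(P)$ satisfies $\mathcal V(P)\subset\{0,1\}^n$ and $|\mathcal V(P)|\ge2$. $f$ is convex and twice continuously differentiable over $P$, with $\|\nabla^2f(x)-\nabla^2f(y)\|\le\beta_2\|x-y\|$ for $x,y\in P$, and $\beta$ is the Lipschitz constant of $\nabla f$ over $P$. $D$ is the Euclidean diameter of $P$. $F^*$ is the optimal value, $x^*$ is the unique minimizer, and quadratic growth holds with constant $\alpha>0$: $\|x-x^*\|^2\le\frac2\alpha(F(x)-F^* )$ for all $x\in P$. Let $\mathcal F^*$ be the lowest-dimensional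 face of $P$ containing $x^*$ and $n^*=\dim\mathcal F^*+1$. Fix $x_t\in P$. Define $Q_t(w)=\langle w-x_t,\nabla f(x_t)\rangle+\frac12\langle w-x_t,\nabla^2f(x_t)(w-x_t)\rangle+\frac{\beta_2}{6}\|w-x_t\|^3$ and $\phi_t=Q_t+R$. The constant $\tilde\beta$ denotes the Lipschitz constant of $\nabla Q_t$ over $P$, and is set to $\tilde\beta=\beta+\frac{\beta_2D}{2}$. Algorithm 2 (decomposition-invariant conditional gradient). Input: step-sizes $(\gamma_i)_{i\ge1}\subset[0,1]$. Set $y_1\in\arg\min_{w\in\mathcal V(P)}\langle w,\nabla Q_t(x_t)\rangle$. For $i=1,2,\dots$: - $w_i^+\in\arg\min_{w\in\mathcal V(P)}\langle w,\nabla Q_t(y_i)\rangle$; - define $\widetilde{\nabla Q_t}(y_i)$ coordinatewise: its $j$th entry equals $[\nabla Q_t(y_i)]_j$ if $y_i(j)>0$ and $-\infty$ if $y_i(j)=0$; - $w_i^-\in\arg\max_{w\in\mathcal V(P)}\langle w,\widetilde{\nabla Q_t}(y_i)\rangle$ (with $0\cdot(-\infty)=0$; i.e. the maximum is effectively over vertices $w$ with $w(j)=0$ whenever $y_i(j)=0$); - $q_i$ is the smallest non-negative integer with $2^{-q_i}\le\gamma_i$, and $\lambda_i=2^{-q_i}$; - if $\phi_t(y_i+\lambda_i(w_i^+-w_i^-))<\phi_t(y_i)$ then $y_{i+1}=y_i+\lambda_i(w_i^+-w_i^-)$; otherwise $y_{i+1}=y_i$. *)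

theory Defs
  imports "HOL-Analysis.Analysis"
begin

definition gradient :: "('a::real_inner \<Rightarrow> real) \<Rightarrow> 'a \<Rightarrow> 'a" where
  "gradient f x = (THE g. GDERIV f x :> g)"

definition hessian :: "(real^'n \<Rightarrow> real) \<Rightarrow> real^'n \<Rightarrow> real^'n^'n" where
  "hessian f x = jacobian (gradient f) (at x)"

(* A polytope given by equality constraints has empty interior, so derivatives are taken in
   the ambient space: f is differentiable near S, and twice differentiable at the points of S
   with a Hessian that is continuous on S.  Being twice continuously differentiable on an open
   superset of S is a special case. *)
definition twice_cont_diff_over :: "(real^'n) set \<Rightarrow> (real^'n \<Rightarrow> real) \<Rightarrow> bool" where
  "twice_cont_diff_over S f \<longleftrightarrow>
     (\<exists>U. open U \<and> S \<subseteq> U \<and> (\<forall>x\<in>U. f differentiable (at x))) \<and>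
     (\<forall>x\<in>S. gradient f differentiable (at x)) \<and>
     continuous_on S (hessian f)"

definition set_ind :: "'a set \<Rightarrow> 'a \<Rightarrow> ereal" where
  "set_ind S x = (if x \<in> S then 0 else \<infinity>)"

definition vertices :: "'a::real_vector set \<Rightarrow> 'a set" where
  "vertices S = {v. v extreme_point_of S}"

definition cubic_model ::
    "(real^'n \<Rightarrow> real) \<Rightarrow> real \<Rightarrow> real^'n \<Rightarrow> real^'n \<Rightarrow> real" where
  "cubic_model f \<beta>\<^sub>2 x w =
     (w - x) \<bullet> gradient f x + (1/2) * ((w - x) \<bullet> (hessian f x *v (w - x)))
     + \<beta>\<^sub>2 / 6 * norm (w - x) ^ 3"

definition masked_gradient :: "(real^'n \<Rightarrow> real) \<Rightarrow> real^'n \<Rightarrow> ereal^'n" where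
  "masked_gradient Q y = (\<chi> j. if y $ j > 0 then ereal (gradient Q y $ j) else -\<infinity>)"

(* In ereal, 0 * (-\<infinity>) = 0, which is the convention wanted here. *)
definition ext_inner :: "real^'n \<Rightarrow> ereal^'n \<Rightarrow> ereal" where
  "ext_inner w g = (\<Sum>j\<in>UNIV. ereal (w $ j) * g $ j)"

(* The sequences y, w\<^sup>+, w\<^sup>-, q (indexed from 1; index 0 is irrelevant) are a run of the
   decomposition-invariant conditional gradient method on Q + set_ind P, started from the model
   centre x, with step sizes \<gamma>.  It is a relation because the arg min / arg max may be attained at
   several vertices.  The least q with 2 powr (-q) \<le> \<gamma> exists only for \<gamma> > 0. *)
definition dicg_run ::
    "(real^'n) set \<Rightarrow> (real^'n \<Rightarrow> real) \<Rightarrow> real^'n \<Rightarrow> (nat \<Rightarrow> real) \<Rightarrow>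
     (nat \<Rightarrow> real^'n) \<Rightarrow> (nat \<Rightarrow> real^'n) \<Rightarrow> (nat \<Rightarrow> real^'n) \<Rightarrow> (nat \<Rightarrow> nat) \<Rightarrow> bool" where
  "dicg_run P Q x \<gamma> y wp wm q \<longleftrightarrow>
     (\<forall>i\<ge>1. 0 \<le> \<gamma> i \<and> \<gamma> i \<le> 1) \<and>
     is_arg_min (\<lambda>w. w \<bullet> gradient Q x) (\<lambda>w. w \<in> vertices P) (y 1) \<and>
     (\<forall>i\<ge>1.
        is_arg_min (\<lambda>w. w \<bullet> gradient Q (y i)) (\<lambda>w. w \<in> vertices P) (wp i) \<and>
        is_arg_max (\<lambda>w. ext_inner w (masked_gradient Q (y i))) (\<lambda>w. w \<in> vertices P) (wm i) \<and>
        (1/2) ^ q i \<le> \<gamma> i \<and> (\<forall>k. (1/2) ^ k \<le> \<gamma> i \<longrightarrow> q i \<le> k) \<and>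
        (let \<phi> = (\<lambda>w. ereal (Q w) + set_ind P w);
             z = y i + (1/2) ^ q i *\<^sub>R (wp i - wm i)
         in y (i + 1) = (if \<phi> z < \<phi> (y i) then z else y i)))"

end

theory Submission
  imports Defs
begin

text \<open>
  Write \<open>xstar\<close> as a convex combination of at most \<open>nstar\<close> vertices of its minimal face. Moving from
  \<open>xstar\<close> to an iterate \<open>y\<close> then amounts to exchanging a mass \<open>\<Delta> \<le> sqrt nstar * norm (y - xstar)\<close> of
  these vertices for a point of \<open>P\<close> supported where \<open>y\<close> is, so by convexity of the model the gap
  \<open>h = Q y - Q xstar\<close> is at most \<open>\<Delta>\<close> times the slope along \<open>wm - wp\<close>. As long as
  \<open>h > \<beta>\<^sub>2 / 3 * norm (x\<^sub>t - xstar) ^ 3\<close>, the cubic model error and quadratic growth bound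
  \<open>norm (y - xstar)\<close> by a multiple of \<open>sqrt h\<close>, and each step contracts the bound on \<open>h\<close> by the factor
  \<open>1 - c\<^sub>1\<close>. The steps are feasible because the coordinates of the iterate are multiples of the dyadic
  step length.
\<close>

section \<open>Gradients and Taylor estimates under a Lipschitz Hessian\<close>

lemma gradient_eqI:
  assumes "GDERIV f x :> g"
  shows "gradient f x = g"
  unfolding gradient_def
proof (rule the_equality)
  fix g' assume "GDERIV f x :> g'"
  then have "(\<lambda>h. inner h g') = (\<lambda>h. inner h g)"
    using assms has_derivative_unique unfolding gderiv_def by blast
  then have "inner (g' - g) g' = inner (g' - g) g" by metis
  then have "inner (g' - g) (g' - g) = 0" by (simp add: inner_diff_right)
  then show "g' = g" by simp
qed (rule assms)

lemma gradient_works: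
  fixes f :: "'a::euclidean_space \<Rightarrow> real"
  assumes "f differentiable (at x)"
  shows "GDERIV f x :> gradient f x"
proof -
  obtain f' where f': "(f has_derivative f') (at x)"
    using assms differentiable_def by blast
  interpret bounded_linear f' using f' by (rule has_derivative_bounded_linear)
  \<comment> \<open>The Riesz representative of the derivative, assembled from its values on the
    orthonormal basis.\<close>
  define g where "g = (\<Sum>b\<in>Basis. f' b *\<^sub>R b)"
  have "f' h = inner h g" for h
  proof -
    have "f' h = f' (\<Sum>b\<in>Basis. (h \<bullet> b) *\<^sub>R b)" by (simp add: euclidean_representation)
    also have "\<dots> = (\<Sum>b\<in>Basis. (h \<bullet> b) * f' b)" by (simp add: sum scaleR)
    also have "\<dots> = inner h g" by (simp add: g_def inner_sum_right mult.commute)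
    finally show ?thesis .
  qed
  then have "GDERIV f x :> g" using f' unfolding gderiv_def by presburger
  then show ?thesis using gradient_eqI by metis
qed

text \<open>Both \<open>h - g\<close> and \<open>h + g\<close> have nonnegative derivatives and are
  therefore nondecreasing. This takes the place of integrating a derivative bound in the Taylor
  estimates.\<close>

lemma abs_diff_le_of_deriv_le:
  fixes g h :: "real \<Rightarrow> real"
  assumes "0 \<le> s"
    and g: "\<And>t. 0 \<le> t \<Longrightarrow> t \<le> s \<Longrightarrow> (g has_real_derivative g' t) (at t)"
    and h: "\<And>t. 0 \<le> t \<Longrightarrow> t \<le> s \<Longrightarrow> (h has_real_derivative h' t) (at t)"
    and le: "\<And>t. 0 \<le> t \<Longrightarrow> t \<le> s \<Longrightarrow> \<bar>g' t\<bar> \<le> h' t"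
  shows "\<bar>g s - g 0\<bar> \<le> h s - h 0"
proof -
  have "h 0 - g 0 \<le> h s - g s"
    by (rule DERIV_nonneg_imp_nondecreasing[OF assms(1), where f = "\<lambda>t. h t - g t"])
       (use DERIV_diff[OF h g] le in \<open>force simp: abs_le_iff\<close>)
  moreover have "h 0 + g 0 \<le> h s + g s"
  proof (rule DERIV_nonneg_imp_nondecreasing[OF assms(1), where f = "\<lambda>t. h t + g t"])
    fix t assume t: "0 \<le> t" "t \<le> s"
    then show "\<exists>y. ((\<lambda>t. h t + g t) has_real_derivative y) (at t) \<and> 0 \<le> y"
      using DERIV_add[OF h[OF t] g[OF t]] le[OF t] by (intro exI[of _ "h' t + g' t"]) linarith
  qed
  ultimately show ?thesis by linarith
qed

text \<open>Derivatives are ambient, but the Hessian is controlled only at points of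
  \<open>S\<close>, which may have empty interior. All estimates therefore run along segments inside
  \<open>S\<close>, where convexity keeps every intermediate point.\<close>

locale lipschitz_hessian =
  fixes S :: "(real^'n) set" and f :: "real^'n \<Rightarrow> real" and L :: real
  assumes convex_S: "convex S"
    and f_diff: "x \<in> S \<Longrightarrow> f differentiable (at x)"
    and grad_diff: "x \<in> S \<Longrightarrow> gradient f differentiable (at x)"
    and hess_lip: "x \<in> S \<Longrightarrow> z \<in> S \<Longrightarrow>
      onorm ((*v) (hessian f x - hessian f z)) \<le> L * norm (x - z)"
begin

lemma hessian_form_lipschitz:
  assumes "x \<in> S" "z \<in> S"
  shows "\<bar>d \<bullet> (hessian f x *v d) - d \<bullet> (hessian f z *v d)\<bar> \<le> L * norm (x - z) * (norm d)\<^sup>2"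
proof -
  let ?M = "hessian f x - hessian f z"
  have "\<bar>d \<bullet> (hessian f x *v d) - d \<bullet> (hessian f z *v d)\<bar> = \<bar>d \<bullet> (?M *v d)\<bar>"
    by (simp add: matrix_vector_mult_diff_rdistrib inner_diff_right)
  also have "\<dots> \<le> norm d * norm (?M *v d)" by (rule Cauchy_Schwarz_ineq2)
  also have "\<dots> \<le> norm d * (onorm ((*v) ?M) * norm d)"
    by (intro mult_left_mono onorm matrix_vector_mul_bounded_linear) auto
  also have "\<dots> \<le> norm d * (L * norm (x - z) * norm d)"
    using hess_lip[OF assms] by (intro mult_left_mono mult_right_mono) auto
  finally show ?thesis by (simp add: power2_eq_square mult_ac)
qed

lemma segment_derivatives:
  assumes "x + s *\<^sub>R d \<in> S"
  shows "((\<lambda>s. f (x + s *\<^sub>R d)) has_real_derivative gradient f (x + s *\<^sub>R d) \<bullet> d) (at s)"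
    and "((\<lambda>s. gradient f (x + s *\<^sub>R d) \<bullet> d) has_real_derivative
           d \<bullet> (hessian f (x + s *\<^sub>R d) *v d)) (at s)"
proof -
  have line: "((\<lambda>s. x + s *\<^sub>R d) has_derivative (\<lambda>h. h *\<^sub>R d)) (at s)"
    by (auto intro!: derivative_eq_intros)
  have "(f has_derivative (\<lambda>h. h \<bullet> gradient f (x + s *\<^sub>R d))) (at (x + s *\<^sub>R d))"
    using gradient_works[OF f_diff[OF assms]] unfolding gderiv_def .
  from has_derivative_compose[OF line this]
  show "((\<lambda>s. f (x + s *\<^sub>R d)) has_real_derivative gradient f (x + s *\<^sub>R d) \<bullet> d) (at s)"
    by (simp add: has_field_derivative_def inner_commute mult.commute[of _ "_ \<bullet> _"])
  have "(gradient f has_derivative (\<lambda>h. hessian f (x + s *\<^sub>R d) *v h)) (at (x + s *\<^sub>R d))"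
    using grad_diff[OF assms] unfolding jacobian_works hessian_def .
  from has_derivative_inner_left[OF has_derivative_compose[OF line this], of d]
  show "((\<lambda>s. gradient f (x + s *\<^sub>R d) \<bullet> d) has_real_derivative
           d \<bullet> (hessian f (x + s *\<^sub>R d) *v d)) (at s)"
    by (simp add: has_field_derivative_def inner_commute matrix_vector_mult_scaleR mult_commute_abs)
qed

lemma segment_in_S:
  assumes "x \<in> S" "x + d \<in> S" "0 \<le> s" "s \<le> 1"
  shows "x + s *\<^sub>R d \<in> S"
proof -
  have "(1 - s) *\<^sub>R x + s *\<^sub>R (x + d) \<in> S"
    using convex_S assms by (intro convexD) auto
  then show ?thesis by (simp add: algebra_simps)
qed

text \<open>Along the segment the Hessian form differs from its value at \<open>x\<close> by at most
  \<open>L * t * norm d ^ 3\<close>; comparing derivatives integrates this bound once, and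
  \<open>taylor\<close> integrates it a second time.\<close>

lemma gradient_taylor:
  assumes S: "x \<in> S" "x + d \<in> S" and s: "0 \<le> s" "s \<le> 1"
  shows "\<bar>gradient f (x + s *\<^sub>R d) \<bullet> d - gradient f x \<bullet> d - s * (d \<bullet> (hessian f x *v d))\<bar>
    \<le> L / 2 * s\<^sup>2 * norm d ^ 3"
proof -
  define k where "k = d \<bullet> (hessian f x *v d)"
  have hess: "\<bar>d \<bullet> (hessian f (x + t *\<^sub>R d) *v d) - k\<bar> \<le> L * t * norm d ^ 3"
    if "0 \<le> t" "t \<le> 1" for t
  proof -
    have "x + t *\<^sub>R d \<in> S" using segment_in_S[OF S that] .
    from hessian_form_lipschitz[OF this S(1), of d] show ?thesis
      using that by (simp add: k_def power2_eq_square power3_eq_cube mult_ac)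
  qed
  have "\<bar>(gradient f (x + s *\<^sub>R d) \<bullet> d - s * k) - (gradient f (x + 0 *\<^sub>R d) \<bullet> d - 0 * k)\<bar>
     \<le> L / 2 * s\<^sup>2 * norm d ^ 3 - L / 2 * 0\<^sup>2 * norm d ^ 3"
  proof (rule abs_diff_le_of_deriv_le[OF s(1)])
    fix t assume t: "0 \<le> t" "t \<le> s"
    with s have "t \<le> 1" by simp
    have tS: "x + t *\<^sub>R d \<in> S" using segment_in_S[OF S t(1) \<open>t \<le> 1\<close>] .
    show "((\<lambda>t. gradient f (x + t *\<^sub>R d) \<bullet> d - t * k) has_real_derivative
        d \<bullet> (hessian f (x + t *\<^sub>R d) *v d) - 1 * k) (at t)"
      by (intro DERIV_diff segment_derivatives(2)[OF tS] DERIV_cmult_right DERIV_ident)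
    show "((\<lambda>t. L / 2 * t\<^sup>2 * norm d ^ 3) has_real_derivative L * t * norm d ^ 3) (at t)"
      by (auto intro!: derivative_eq_intros)
    show "\<bar>d \<bullet> (hessian f (x + t *\<^sub>R d) *v d) - 1 * k\<bar> \<le> L * t * norm d ^ 3"
      using hess[OF t(1) \<open>t \<le> 1\<close>] by simp
  qed
  then show ?thesis by (simp add: k_def algebra_simps)
qed

lemma taylor:
  assumes S: "x \<in> S" "x + d \<in> S" and s: "0 \<le> s" "s \<le> 1"
  shows "\<bar>f (x + s *\<^sub>R d) - f x - s * (gradient f x \<bullet> d) - s\<^sup>2 / 2 * (d \<bullet> (hessian f x *v d))\<bar>
    \<le> L / 6 * s ^ 3 * norm d ^ 3"
proof -
  define g where "g = gradient f x \<bullet> d"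
  define k where "k = d \<bullet> (hessian f x *v d)"
  have grad: "\<bar>gradient f (x + t *\<^sub>R d) \<bullet> d - g - t * k\<bar> \<le> L / 2 * t\<^sup>2 * norm d ^ 3"
    if "0 \<le> t" "t \<le> 1" for t
    using gradient_taylor[OF S that] by (simp add: g_def k_def)
  have "\<bar>(f (x + s *\<^sub>R d) - s * g - s\<^sup>2 / 2 * k) - (f (x + 0 *\<^sub>R d) - 0 * g - 0\<^sup>2 / 2 * k)\<bar>
     \<le> L / 6 * s ^ 3 * norm d ^ 3 - L / 6 * 0 ^ 3 * norm d ^ 3"
  proof (rule abs_diff_le_of_deriv_le[OF s(1)])
    fix t assume t: "0 \<le> t" "t \<le> s"
    with s have "t \<le> 1" by simp
    have tS: "x + t *\<^sub>R d \<in> S" using segment_in_S[OF S t(1) \<open>t \<le> 1\<close>] .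
    show "((\<lambda>t. f (x + t *\<^sub>R d) - t * g - t\<^sup>2 / 2 * k) has_real_derivative
        gradient f (x + t *\<^sub>R d) \<bullet> d - 1 * g - t * k) (at t)"
    proof (intro DERIV_diff segment_derivatives(1)[OF tS] DERIV_cmult_right DERIV_ident)
      show "((\<lambda>t. t\<^sup>2 / 2) has_real_derivative t) (at t)"
        by (auto intro!: derivative_eq_intros)
    qed
    show "((\<lambda>t. L / 6 * t ^ 3 * norm d ^ 3) has_real_derivative L / 2 * t\<^sup>2 * norm d ^ 3) (at t)"
      by (auto intro!: derivative_eq_intros)
    show "\<bar>gradient f (x + t *\<^sub>R d) \<bullet> d - 1 * g - t * k\<bar> \<le> L / 2 * t\<^sup>2 * norm d ^ 3"
      using grad[OF t(1) \<open>t \<le> 1\<close>] by simp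
  qed
  then show ?thesis by (simp add: g_def k_def algebra_simps)
qed

end

section \<open>Curvature bounds as limits of small steps\<close>

lemma le_of_le_add_small:
  fixes a b c :: real
  assumes "\<And>s. 0 < s \<Longrightarrow> s < 1 \<Longrightarrow> a \<le> b + c * s"
  shows "a \<le> b"
proof (rule tendsto_lowerbound)
  show "((\<lambda>s. b + c * s) \<longlongrightarrow> b) (at_right 0)"
    by (auto intro!: tendsto_eq_intros)
  show "\<forall>\<^sub>F s in at_right 0. a \<le> b + c * s"
    using assms by (auto simp: eventually_at_right_field intro!: exI[of _ 1])
qed simp

context lipschitz_hessian
begin

text \<open>Midpoint convexity on the segment from \<open>x\<close> to
  \<open>x + s *\<^sub>R d\<close> is expanded by \<open>taylor\<close> at \<open>s\<close> and at
  \<open>s/2\<close>. The linear terms cancel, the quadratic ones leave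
  \<open>s\<^sup>2 / 4 * k\<close>, and the cubic errors vanish relative to this as s tends to
  0.\<close>

lemma hessian_form_nonneg_feasible:
  assumes f: "convex_on S f" and S: "x \<in> S" "x + d \<in> S"
  shows "0 \<le> d \<bullet> (hessian f x *v d)"
proof (rule le_of_le_add_small[where c = "5 * L / 6 * norm d ^ 3"])
  fix s :: real assume s: "0 < s" "s < 1"
  define g where "g = gradient f x \<bullet> d"
  define k where "k = d \<bullet> (hessian f x *v d)"
  define N where "N = norm d ^ 3"
  have "f ((1/2) *\<^sub>R x + (1/2) *\<^sub>R (x + s *\<^sub>R d)) \<le> 1/2 * f x + 1/2 * f (x + s *\<^sub>R d)"
    using segment_in_S[OF S, of s] s S convex_onD[OF f, of "1/2" x "x + s *\<^sub>R d"] by simp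
  moreover have "(1/2) *\<^sub>R x + (1/2) *\<^sub>R (x + s *\<^sub>R d) = x + (s/2) *\<^sub>R d"
    by (simp add: vec_eq_iff field_simps)
  ultimately have "2 * f (x + (s/2) *\<^sub>R d) \<le> f x + f (x + s *\<^sub>R d)" by simp
  moreover have "f (x + s *\<^sub>R d) \<le> f x + s * g + s\<^sup>2 / 2 * k + L / 6 * s ^ 3 * N"
    using taylor[OF S, of s] s unfolding g_def k_def N_def by linarith
  moreover have "f (x + (s/2) *\<^sub>R d) \<ge> f x + (s/2) * g + (s/2)\<^sup>2 / 2 * k - L / 6 * (s/2) ^ 3 * N"
    using taylor[OF S, of "s/2"] s unfolding g_def k_def N_def by linarith
  \<comment> \<open>The errors add up to \<open>L / 6 * (1 + 2 / 8) * s ^ 3 * N\<close>; taking out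
    \<open>s\<^sup>2 / 4\<close> leaves the factor 5/6.\<close>
  ultimately have "0 \<le> s\<^sup>2 / 4 * (k + 5 * L / 6 * N * s)"
    by (simp add: power2_eq_square power3_eq_cube field_simps)
  then show "0 \<le> k + 5 * L / 6 * N * s" using s by (simp add: zero_le_mult_iff)
qed

text \<open>The form is the limit of difference quotients of the gradient along \<open>d\<close>,
  each bounded by the Lipschitz constant of the gradient.\<close>

lemma hessian_form_le_feasible:
  assumes g: "\<And>x z. x \<in> S \<Longrightarrow> z \<in> S \<Longrightarrow> norm (gradient f x - gradient f z) \<le> \<beta> * norm (x - z)"
    and S: "x \<in> S" "x + d \<in> S"
  shows "d \<bullet> (hessian f x *v d) \<le> \<beta> * (norm d)\<^sup>2"
proof (rule le_of_le_add_small[where c = "L / 2 * norm d ^ 3"])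
  fix s :: real assume s: "0 < s" "s < 1"
  define k where "k = d \<bullet> (hessian f x *v d)"
  have "x + s *\<^sub>R d \<in> S" using segment_in_S[OF S, of s] s by simp
  have "gradient f (x + s *\<^sub>R d) \<bullet> d - gradient f x \<bullet> d = (gradient f (x + s *\<^sub>R d) - gradient f x) \<bullet> d"
    by (simp add: inner_diff_left)
  also have "\<dots> \<le> norm (gradient f (x + s *\<^sub>R d) - gradient f x) * norm d" by (rule norm_cauchy_schwarz)
  also have "\<dots> \<le> \<beta> * norm (x + s *\<^sub>R d - x) * norm d"
    using g[OF \<open>x + s *\<^sub>R d \<in> S\<close> S(1)] by (rule mult_right_mono) simp
  also have "\<dots> = s * (\<beta> * (norm d)\<^sup>2)" using s by (simp add: power2_eq_square)
  finally have "s * k \<le> s * (\<beta> * (norm d)\<^sup>2) + L / 2 * s\<^sup>2 * norm d ^ 3"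
    using gradient_taylor[OF S, of s] s unfolding k_def by linarith
  then have "s * k \<le> s * (\<beta> * (norm d)\<^sup>2 + L / 2 * norm d ^ 3 * s)"
    by (simp add: power2_eq_square algebra_simps)
  then show "k \<le> \<beta> * (norm d)\<^sup>2 + L / 2 * norm d ^ 3 * s" using s by simp
qed

text \<open>The direction \<open>p - p'\<close> need not be feasible at \<open>x\<close>, but it is feasible (up to scaling) at the
  points \<open>x + s (m - x)\<close> with \<open>m\<close> the midpoint of \<open>p\<close> and \<open>p'\<close>, which tend to \<open>x\<close>.\<close>

lemma hessian_form_bounds:
  assumes f: "convex_on S f"
    and g: "\<And>x z. x \<in> S \<Longrightarrow> z \<in> S \<Longrightarrow> norm (gradient f x - gradient f z) \<le> \<beta> * norm (x - z)"
    and S: "x \<in> S" "p \<in> S" "p' \<in> S"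
  defines "d \<equiv> p - p'"
  shows "0 \<le> d \<bullet> (hessian f x *v d)" and "d \<bullet> (hessian f x *v d) \<le> \<beta> * (norm d)\<^sup>2"
proof -
  define m where "m = (1/2) *\<^sub>R (p + p')"
  define c where "c = L * norm (m - x) * (norm d)\<^sup>2"
  have *: "0 \<le> d \<bullet> (hessian f x *v d) + c * s"
          "d \<bullet> (hessian f x *v d) \<le> \<beta> * (norm d)\<^sup>2 + c * s" if s: "0 < s" "s < 1" for s
  proof -
    define z where "z = x + s *\<^sub>R (m - x)"
    have "m \<in> S" using convexD[OF convex_S S(2,3), of "1/2" "1/2"] by (simp add: m_def scaleR_add_right)
    then have z: "z \<in> S" using segment_in_S[of x "m - x" s] S s by (simp add: z_def)
    \<comment> \<open>From \<open>z\<close> the scaled direction leads to a point of the segment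
      from \<open>x\<close> to \<open>p\<close>, so it is feasible at \<open>z\<close>.\<close>
    have "z + (s/2) *\<^sub>R d = x + s *\<^sub>R (p - x)"
      by (simp add: z_def d_def m_def vec_eq_iff field_simps)
    then have zd: "z + (s/2) *\<^sub>R d \<in> S" using segment_in_S[of x "p - x" s] S s by simp
    have q: "((s/2) *\<^sub>R d) \<bullet> (hessian f z *v ((s/2) *\<^sub>R d)) = (s/2)\<^sup>2 * (d \<bullet> (hessian f z *v d))"
      by (simp add: matrix_vector_mult_scaleR power2_eq_square)
    have "0 \<le> (s/2)\<^sup>2 * (d \<bullet> (hessian f z *v d))"
      using hessian_form_nonneg_feasible[OF f z zd] unfolding q .
    then have lo: "0 \<le> d \<bullet> (hessian f z *v d)" using s by (simp add: zero_le_mult_iff)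
    have "(s/2)\<^sup>2 * (d \<bullet> (hessian f z *v d)) \<le> (s/2)\<^sup>2 * (\<beta> * (norm d)\<^sup>2)"
      using hessian_form_le_feasible[OF g z zd] s unfolding q by (simp add: power_mult_distrib power_divide mult_ac)
    then have hi: "d \<bullet> (hessian f z *v d) \<le> \<beta> * (norm d)\<^sup>2" using s by simp
    have "\<bar>d \<bullet> (hessian f z *v d) - d \<bullet> (hessian f x *v d)\<bar> \<le> c * s"
      using hessian_form_lipschitz[OF z S(1), of d] s by (simp add: z_def c_def mult_ac)
    with lo hi show "0 \<le> d \<bullet> (hessian f x *v d) + c * s"
      "d \<bullet> (hessian f x *v d) \<le> \<beta> * (norm d)\<^sup>2 + c * s" by (auto simp: abs_le_iff)
  qed
  show "0 \<le> d \<bullet> (hessian f x *v d)" by (rule le_of_le_add_small) (rule *(1))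
  show "d \<bullet> (hessian f x *v d) \<le> \<beta> * (norm d)\<^sup>2" by (rule le_of_le_add_small) (rule *(2))
qed

end

section \<open>The cubic model: expansion, error, convexity and descent\<close>

text \<open>Polarization turns the claim into polynomial algebra in three norms. The bracket is
  visibly nonnegative and of second order in \<open>e\<close>, which yields both the gradient of the
  cube and its convexity.\<close>

lemma norm_cube_expansion:
  fixes u e :: "'a::real_inner"
  shows "norm (u + e) ^ 3 = norm u ^ 3 + 3 * norm u * (u \<bullet> e)
    + ((norm (u + e) - norm u)\<^sup>2 * (norm (u + e) + norm u / 2) + 3 / 2 * norm u * (norm e)\<^sup>2)"
proof -
  have "(norm (u + e))\<^sup>2 = (norm u)\<^sup>2 + 2 * (u \<bullet> e) + (norm e)\<^sup>2"
    by (simp add: power2_norm_eq_inner inner_add_left inner_add_right inner_commute)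
  then have "u \<bullet> e = ((norm (u + e))\<^sup>2 - (norm u)\<^sup>2 - (norm e)\<^sup>2) / 2" by simp
  then show ?thesis unfolding \<open>u \<bullet> e = _\<close>
    by (simp add: power2_eq_square power3_eq_cube field_simps)
qed

lemma norm_cube_remainder_le:
  fixes u e :: "'a::real_inner"
  shows "(norm (u + e) - norm u)\<^sup>2 * (norm (u + e) + norm u / 2) + 3 / 2 * norm u * (norm e)\<^sup>2
    \<le> (norm (u + e) + 2 * norm u) * (norm e)\<^sup>2"
proof -
  have "\<bar>norm (u + e) - norm u\<bar> \<le> norm e"
    using norm_triangle_ineq3[of "u + e" u] by simp
  then have "(norm (u + e) - norm u)\<^sup>2 \<le> (norm e)\<^sup>2"
    by (simp add: power2_le_iff_abs_le)
  then have "(norm (u + e) - norm u)\<^sup>2 * (norm (u + e) + norm u / 2)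
      \<le> (norm e)\<^sup>2 * (norm (u + e) + norm u / 2)"
    by (rule mult_right_mono) simp
  then show ?thesis by (simp add: algebra_simps)
qed

text \<open>The factor growing with \<open>norm h\<close> is allowed because the remainder of the
  cubed norm contains \<open>norm (u + h)\<close>.\<close>

lemma GDERIV_of_quadratic_remainder:
  fixes f :: "'a::real_inner \<Rightarrow> real"
  assumes "\<And>h. \<bar>f (x + h) - f x - h \<bullet> g\<bar> \<le> (C + K * norm h) * (norm h)\<^sup>2"
  shows "GDERIV f x :> g"
  unfolding gderiv_def has_derivative_at
proof
  have "isCont (\<lambda>h::'a. (C + K * norm h) * norm h) 0" by (intro continuous_intros)
  then have lim: "((\<lambda>h. (C + K * norm h) * norm h) \<longlongrightarrow> 0) (at (0::'a))" by (simp add: isCont_def)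
  show "((\<lambda>h. norm (f (x + h) - f x - h \<bullet> g) / norm h) \<longlongrightarrow> 0) (at 0)"
  proof (rule Lim_null_comparison)
    show "((\<lambda>h. (C + K * norm h) * norm h) \<longlongrightarrow> 0) (at (0::'a))" using lim .
    show "\<forall>\<^sub>F h in at 0. norm (norm (f (x + h) - f x - h \<bullet> g) / norm h) \<le> (C + K * norm h) * norm h"
      using assms by (intro always_eventually)
        (auto simp: divide_le_eq power2_eq_square mult_ac)
  qed
qed (rule bounded_linear_inner_left)

text \<open>An exact second-order expansion. Its remainder identifies the gradient, gives convexity
  when bounded below, and gives the descent estimate when bounded above.\<close>

lemma cubic_model_expansion:
  fixes f :: "real^'n \<Rightarrow> real"
  defines "H x \<equiv> hessian f x"
  shows "cubic_model f L x (w + e) = cubic_model f L x w + e \<bullet> gradient (cubic_model f L x) w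
    + e \<bullet> (H x *v e) / 2
    + L / 6 * ((norm (w + e - x) - norm (w - x))\<^sup>2 * (norm (w + e - x) + norm (w - x) / 2)
               + 3 / 2 * norm (w - x) * (norm e)\<^sup>2)"
proof -
  define u where "u = w - x"
  \<comment> \<open>The symmetrized product is the gradient of the quadratic form without appeal to
    symmetry of the Hessian.\<close>
  define g where "g = gradient f x + (1/2) *\<^sub>R (H x *v u + u v* H x) + (L / 2 * norm u) *\<^sub>R u"
  define r where "r h = (norm (u + h) - norm u)\<^sup>2 * (norm (u + h) + norm u / 2)
               + 3 / 2 * norm u * (norm h)\<^sup>2" for h
  have exp: "cubic_model f L x (w + h) = cubic_model f L x w + h \<bullet> g + h \<bullet> (H x *v h) / 2 + L / 6 * r h" for h
  proof -
    have wh: "w + h - x = u + h" by (simp add: u_def)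
    have "cubic_model f L x (w + h) = (u + h) \<bullet> gradient f x
        + 1/2 * ((u + h) \<bullet> (H x *v (u + h))) + L / 6 * norm (u + h) ^ 3"
      unfolding cubic_model_def wh H_def ..
    also have "norm (u + h) ^ 3 = norm u ^ 3 + 3 * norm u * (u \<bullet> h) + r h"
      unfolding r_def by (rule norm_cube_expansion)
    also have "(u + h) \<bullet> (H x *v (u + h)) = u \<bullet> (H x *v u) + h \<bullet> (H x *v u) + h \<bullet> (u v* H x) + h \<bullet> (H x *v h)"
      by (simp add: matrix_vector_right_distrib inner_add_left inner_add_right dot_lmul_matrix inner_commute[of h "u v* H x"])
    finally have "cubic_model f L x (w + h) = (u + h) \<bullet> gradient f x
        + 1/2 * (u \<bullet> (H x *v u) + h \<bullet> (H x *v u) + h \<bullet> (u v* H x) + h \<bullet> (H x *v h))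
        + L / 6 * (norm u ^ 3 + 3 * norm u * (u \<bullet> h) + r h)" .
    moreover have "cubic_model f L x w = u \<bullet> gradient f x + 1/2 * (u \<bullet> (H x *v u)) + L / 6 * norm u ^ 3"
      unfolding cubic_model_def u_def H_def ..
    ultimately show ?thesis
      by (simp add: g_def inner_add_left inner_add_right inner_commute algebra_simps)
  qed
  have "GDERIV (cubic_model f L x) w :> g"
  proof (rule GDERIV_of_quadratic_remainder)
    fix h
    have "\<bar>h \<bullet> (H x *v h)\<bar> \<le> norm h * norm (H x *v h)" by (rule Cauchy_Schwarz_ineq2)
    also have "\<dots> \<le> norm h * (onorm ((*v) (H x)) * norm h)"
      by (intro mult_left_mono onorm matrix_vector_mul_bounded_linear) auto
    finally have 1: "\<bar>h \<bullet> (H x *v h) / 2\<bar> \<le> onorm ((*v) (H x)) / 2 * (norm h)\<^sup>2"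
      by (simp add: power2_eq_square mult_ac)
    have "r h \<le> (norm (u + h) + 2 * norm u) * (norm h)\<^sup>2"
      unfolding r_def by (rule norm_cube_remainder_le)
    also have "\<dots> \<le> (norm h + 3 * norm u) * (norm h)\<^sup>2"
      using norm_triangle_ineq[of u h] by (intro mult_right_mono) auto
    finally have "\<bar>L / 6\<bar> * r h \<le> \<bar>L / 6\<bar> * ((norm h + 3 * norm u) * (norm h)\<^sup>2)"
      by (rule mult_left_mono) simp
    moreover have "0 \<le> r h" unfolding r_def by simp
    ultimately have 2: "\<bar>L / 6 * r h\<bar> \<le> \<bar>L / 6\<bar> * ((norm h + 3 * norm u) * (norm h)\<^sup>2)"
      by (simp add: abs_mult)
    have "\<bar>h \<bullet> (H x *v h) / 2 + L / 6 * r h\<bar>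
      \<le> onorm ((*v) (H x)) / 2 * (norm h)\<^sup>2 + \<bar>L / 6\<bar> * ((norm h + 3 * norm u) * (norm h)\<^sup>2)"
      using 1 2 by linarith
    then show "\<bar>cubic_model f L x (w + h) - cubic_model f L x w - h \<bullet> g\<bar>
      \<le> (onorm ((*v) (H x)) / 2 + \<bar>L / 6\<bar> * 3 * norm u + \<bar>L / 6\<bar> * norm h) * (norm h)\<^sup>2"
      unfolding exp by (simp add: algebra_simps)
  qed
  then have "gradient (cubic_model f L x) w = g" by (rule gradient_eqI)
  with exp[of e] show ?thesis by (simp add: r_def u_def algebra_simps)
qed

text \<open>At the centre the second-order part of the expansion coincides with that of the
  definition, so the linear parts agree in every direction \<open>e\<close>.\<close>

lemma gradient_cubic_model_center:
  "gradient (cubic_model f L x) x = gradient f x"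
proof (rule vector_eq_ldot[THEN iffD1], rule allI)
  fix e
  show "e \<bullet> gradient (cubic_model f L x) x = e \<bullet> gradient f x"
    using cubic_model_expansion[of f L x x e]
    by (simp add: cubic_model_def power2_eq_square power3_eq_cube)
qed

context lipschitz_hessian
begin

text \<open>The Taylor error is at most \<open>L / 6 * norm (w - x) ^ 3\<close>. The cubic term of
  the model makes up for it from below and doubles it from above, hence the factor 1/3.\<close>

lemma cubic_model_error:
  assumes "x \<in> S" "w \<in> S"
  shows "f w \<le> f x + cubic_model f L x w"
    and "cubic_model f L x w \<le> f w - f x + L / 3 * norm (w - x) ^ 3"
proof -
  have "\<bar>f w - f x - gradient f x \<bullet> (w - x) - 1 / 2 * ((w - x) \<bullet> (hessian f x *v (w - x)))\<bar>
      \<le> L / 6 * norm (w - x) ^ 3"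
    using taylor[of x "w - x" 1] assms by simp
  then show "f w \<le> f x + cubic_model f L x w"
    and "cubic_model f L x w \<le> f w - f x + L / 3 * norm (w - x) ^ 3"
    unfolding cubic_model_def by (simp_all only: inner_commute[of "gradient f x"])
qed

text \<open>The Hessian contributes curvature \<beta>. In the cubic remainder three norms are
  bounded by the diameter, so it contributes \<open>L / 6 * 3 * D\<close>, that is curvature
  \<open>L * D\<close>.\<close>

lemma cubic_model_descent:
  assumes f: "convex_on S f"
    and g: "\<And>x z. x \<in> S \<Longrightarrow> z \<in> S \<Longrightarrow> norm (gradient f x - gradient f z) \<le> \<beta> * norm (x - z)"
    and diam: "\<And>x z. x \<in> S \<Longrightarrow> z \<in> S \<Longrightarrow> norm (x - z) \<le> D"
    and "0 \<le> L" and S: "x \<in> S" "p \<in> S" "p' \<in> S" "w \<in> S" "w + t *\<^sub>R (p - p') \<in> S"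
  shows "cubic_model f L x (w + t *\<^sub>R (p - p')) \<le> cubic_model f L x w
    + t * ((p - p') \<bullet> gradient (cubic_model f L x) w) + t\<^sup>2 / 2 * (\<beta> + L * D) * (norm (p - p'))\<^sup>2"
proof -
  define d e where "d = p - p'" and "e = t *\<^sub>R d"
  have "d \<bullet> (hessian f x *v d) \<le> \<beta> * (norm d)\<^sup>2"
    unfolding d_def using hessian_form_bounds(2)[OF f g S(1-3)] .
  then have "t\<^sup>2 * (d \<bullet> (hessian f x *v d)) \<le> t\<^sup>2 * (\<beta> * (norm d)\<^sup>2)" by (rule mult_left_mono) simp
  then have 1: "e \<bullet> (hessian f x *v e) / 2 \<le> t\<^sup>2 / 2 * \<beta> * (norm d)\<^sup>2"
    by (simp add: e_def matrix_vector_mult_scaleR power2_eq_square mult_ac)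
  define u where "u = w - x"
  have ue: "w + e - x = u + e" by (simp add: u_def)
  have "norm (u + e) \<le> D" "norm u \<le> D" using diam[OF S(5,1)] diam[OF S(4,1)]
    unfolding ue[symmetric] by (simp_all add: u_def e_def d_def)
  then have "(norm (u + e) + 2 * norm u) * (norm e)\<^sup>2 \<le> (3 * D) * (norm e)\<^sup>2"
    by (intro mult_right_mono) auto
  with norm_cube_remainder_le[of u e]
  have "(norm (u + e) - norm u)\<^sup>2 * (norm (u + e) + norm u / 2) + 3 / 2 * norm u * (norm e)\<^sup>2
    \<le> 3 * D * (norm e)\<^sup>2" by linarith
  then have "L / 6 * ((norm (u + e) - norm u)\<^sup>2 * (norm (u + e) + norm u / 2) + 3 / 2 * norm u * (norm e)\<^sup>2)
    \<le> L / 6 * (3 * D * (norm e)\<^sup>2)" using \<open>0 \<le> L\<close> by (intro mult_left_mono) auto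
  also have "\<dots> = t\<^sup>2 / 2 * (L * D) * (norm d)\<^sup>2" by (simp add: e_def power_mult_distrib)
  finally have "cubic_model f L x (w + e) \<le> cubic_model f L x w
    + e \<bullet> gradient (cubic_model f L x) w + (t\<^sup>2 / 2 * \<beta> * (norm d)\<^sup>2 + t\<^sup>2 / 2 * (L * D) * (norm d)\<^sup>2)"
    using 1 cubic_model_expansion[of f L x w e] unfolding ue unfolding u_def by linarith
  then show ?thesis by (simp add: e_def d_def algebra_simps add_divide_distrib)
qed

text \<open>The model is convex on \<open>S\<close>: both second-order terms of the exact expansion
  are nonnegative.\<close>

lemma cubic_model_tangent:
  assumes f: "convex_on S f"
    and g: "\<And>x z. x \<in> S \<Longrightarrow> z \<in> S \<Longrightarrow> norm (gradient f x - gradient f z) \<le> \<beta> * norm (x - z)"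
    and "0 \<le> L" and S: "x \<in> S" "w \<in> S" "z \<in> S"
  shows "cubic_model f L x w + (z - w) \<bullet> gradient (cubic_model f L x) w \<le> cubic_model f L x z"
proof -
  have "0 \<le> (z - w) \<bullet> (hessian f x *v (z - w))"
    using hessian_form_bounds(1)[OF f g S(1) S(3,2)] .
  then show ?thesis
    using cubic_model_expansion[of f L x w "z - w"] \<open>0 \<le> L\<close> by simp
qed

lemma cubic_model_upper:
  assumes g: "\<And>x z. x \<in> S \<Longrightarrow> z \<in> S \<Longrightarrow> norm (gradient f x - gradient f z) \<le> \<beta> * norm (x - z)"
    and S: "x \<in> S" "w \<in> S"
  shows "cubic_model f L x w \<le> (w - x) \<bullet> gradient f x + \<beta> / 2 * (norm (w - x))\<^sup>2 + L / 6 * norm (w - x) ^ 3"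
  using hessian_form_le_feasible[OF g, of x "w - x"] S by (simp add: cubic_model_def)

text \<open>The mean value theorem on each half gives two intermediate points at distance at most
  \<open>2 * norm d\<close>. The bound serves to compare the growth constant \<alpha> with
  \<beta>.\<close>

lemma symmetric_second_difference_le:
  assumes g: "\<And>x z. x \<in> S \<Longrightarrow> z \<in> S \<Longrightarrow> norm (gradient f x - gradient f z) \<le> \<beta> * norm (x - z)"
    and "0 \<le> \<beta>" and S: "x - d \<in> S" "x + d \<in> S"
  shows "f (x + d) + f (x - d) - 2 * f x \<le> 2 * \<beta> * (norm d)\<^sup>2"
proof -
  have xS: "x + t *\<^sub>R d \<in> S" if "-1 \<le> t" "t \<le> 1" for t
  proof -
    have "x - d + 2 *\<^sub>R d = x + d" by (simp add: vec_eq_iff)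
    with S(2) have "x - d + 2 *\<^sub>R d \<in> S" by (simp only:)
    from segment_in_S[OF S(1) this, of "(1 + t) / 2"] that
    have "x - d + ((1 + t) / 2) *\<^sub>R (2 *\<^sub>R d) \<in> S" by simp
    moreover have "x - d + ((1 + t) / 2) *\<^sub>R (2 *\<^sub>R d) = x + t *\<^sub>R d"
      by (simp add: vec_eq_iff field_simps)
    ultimately show ?thesis by (simp only:)
  qed
  have "\<exists>s>0. s < 1 \<and> f (x + 1 *\<^sub>R d) - f (x + 0 *\<^sub>R d) = (1 - 0) * (gradient f (x + s *\<^sub>R d) \<bullet> d)"
    by (rule MVT2) (use xS in \<open>auto intro!: segment_derivatives(1)\<close>)
  then obtain s where s: "0 < s" "s < 1" "f (x + d) - f x = gradient f (x + s *\<^sub>R d) \<bullet> d" by auto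
  have "\<exists>r>-1. r < 0 \<and> f (x + 0 *\<^sub>R d) - f (x + (-1) *\<^sub>R d) = (0 - (-1)) * (gradient f (x + r *\<^sub>R d) \<bullet> d)"
    by (rule MVT2) (use xS in \<open>auto intro!: segment_derivatives(1)\<close>)
  then obtain r where r: "-1 < r" "r < 0" "f x - f (x - d) = gradient f (x + r *\<^sub>R d) \<bullet> d" by auto
  have "f (x + d) + f (x - d) - 2 * f x = (gradient f (x + s *\<^sub>R d) - gradient f (x + r *\<^sub>R d)) \<bullet> d"
    using s(3) r(3) by (simp add: inner_diff_left)
  also have "\<dots> \<le> norm (gradient f (x + s *\<^sub>R d) - gradient f (x + r *\<^sub>R d)) * norm d"
    by (rule norm_cauchy_schwarz)
  also have "\<dots> \<le> \<beta> * norm ((x + s *\<^sub>R d) - (x + r *\<^sub>R d)) * norm d"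
    using g[OF xS xS] s r by (intro mult_right_mono) auto
  also have "norm ((x + s *\<^sub>R d) - (x + r *\<^sub>R d)) = (s - r) * norm d"
    using s r by (simp flip: scaleR_diff_left)
  also have "\<beta> * ((s - r) * norm d) * norm d \<le> \<beta> * (2 * norm d) * norm d"
    using s r \<open>0 \<le> \<beta>\<close> by (intro mult_right_mono mult_left_mono) auto
  finally show ?thesis by (simp add: power2_eq_square)
qed

end

section \<open>Exchanging vertex mass against another point of the polytope\<close>

text \<open>Greedy choice: the constraint \<open>\<Sum>u. \<nu> u * u $ j \<le> y $ j\<close> that blocks an element stays tight
  when further elements are added.\<close>

lemma greedy_packing:
  fixes S :: "(real^'n) set" and y :: "real^'n"
  assumes "finite S" and "\<And>u. u \<in> S \<Longrightarrow> 0 \<le> \<rho> u"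
    and "\<And>u j. u \<in> S \<Longrightarrow> u $ j \<in> {0, 1}" and "\<And>j. 0 \<le> y $ j"
  shows "\<exists>\<nu>. (\<forall>u\<in>S. 0 \<le> \<nu> u \<and> \<nu> u \<le> \<rho> u) \<and> (\<forall>j. (\<Sum>u\<in>S. \<nu> u * u $ j) \<le> y $ j) \<and>
    (\<forall>u\<in>S. \<nu> u < \<rho> u \<longrightarrow> (\<exists>j. u $ j = 1 \<and> (\<Sum>u\<in>S. \<nu> u * u $ j) = y $ j))"
proof -
  have "\<forall>u\<in>S. 0 \<le> \<rho> u" "\<forall>u\<in>S. \<forall>j. u $ j \<in> {0, 1}" using assms(2,3) by blast+
  with assms(1) show ?thesis
  proof (induction S rule: finite_induct)
    case empty
    then show ?case using assms(4) by simp
  next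
    case (insert w S)
    have "\<forall>u\<in>S. 0 \<le> \<rho> u" "\<forall>u\<in>S. \<forall>j. u $ j \<in> {0, 1}"
      using insert.prems by blast+
    from insert.IH[OF this]
    obtain \<nu> where \<nu>: "\<forall>u\<in>S. 0 \<le> \<nu> u \<and> \<nu> u \<le> \<rho> u"
      "\<forall>j. (\<Sum>u\<in>S. \<nu> u * u $ j) \<le> y $ j"
      "\<forall>u\<in>S. \<nu> u < \<rho> u \<longrightarrow> (\<exists>j. u $ j = 1 \<and> (\<Sum>u\<in>S. \<nu> u * u $ j) = y $ j)"
      by (elim exE conjE)
    \<comment> \<open>The minimum of \<open>M\<close> is the largest admissible weight for
      \<open>w\<close>: its quota, or the least slack among its coordinates.\<close>
    define M where "M = insert (\<rho> w) ((\<lambda>j. y $ j - (\<Sum>u\<in>S. \<nu> u * u $ j)) ` {j. w $ j = 1})"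
    define a where "a = Min M"
    have M: "finite M" "M \<noteq> {}" by (auto simp: M_def)
    have a: "0 \<le> a" "a \<le> \<rho> w" "\<And>j. w $ j = 1 \<Longrightarrow> a \<le> y $ j - (\<Sum>u\<in>S. \<nu> u * u $ j)"
      using M \<nu>(2) insert.prems(1) by (auto simp: a_def M_def)
    have tight: "\<exists>j. w $ j = 1 \<and> a = y $ j - (\<Sum>u\<in>S. \<nu> u * u $ j)" if "a < \<rho> w"
      using Min_in[OF M] that by (auto simp: a_def M_def)
    have w01: "w $ j = 0 \<or> w $ j = 1" for j using insert.prems(2) by auto
    have sum: "(\<Sum>u\<in>insert w S. (\<nu>(w := a)) u * u $ j) = a * w $ j + (\<Sum>u\<in>S. \<nu> u * u $ j)" for j
      using insert.hyps by (subst sum.insert) (auto intro!: sum.cong)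
    show ?case
    proof (intro exI[of _ "\<nu>(w := a)"] conjI allI ballI impI)
      fix u assume "u \<in> insert w S"
      then show "0 \<le> (\<nu>(w := a)) u" "(\<nu>(w := a)) u \<le> \<rho> u" using a \<nu>(1) by auto
    next
      fix j show "(\<Sum>u\<in>insert w S. (\<nu>(w := a)) u * u $ j) \<le> y $ j"
        unfolding sum using a(3)[of j] w01[of j] \<nu>(2)[rule_format, of j] by auto
    next
      fix u assume u: "u \<in> insert w S" "(\<nu>(w := a)) u < \<rho> u"
      show "\<exists>j. u $ j = 1 \<and> (\<Sum>u\<in>insert w S. (\<nu>(w := a)) u * u $ j) = y $ j"
      proof (cases "u = w")
        case True
        with u tight obtain j where "w $ j = 1" "a = y $ j - (\<Sum>u\<in>S. \<nu> u * u $ j)" by auto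
        then show ?thesis unfolding sum True by (intro exI[of _ j]) simp
      next
        case False
        with u \<nu>(3) obtain j where j: "u $ j = 1" "(\<Sum>u\<in>S. \<nu> u * u $ j) = y $ j" by auto
        then have "w $ j = 1 \<Longrightarrow> a = 0" using a(1) a(3)[of j] by simp
        then have "a * w $ j = 0" using w01[of j] by auto
        with j show ?thesis unfolding sum by (intro exI[of _ j]) simp
      qed
    qed
  qed
qed

lemma bounded_no_nonneg_ray:
  fixes x r :: "'a::real_normed_vector"
  assumes "bounded P" and "\<And>t. 0 \<le> t \<Longrightarrow> x + t *\<^sub>R r \<in> P"
  shows "r = 0"
proof (rule ccontr)
  assume "r \<noteq> 0"
  obtain B where B: "\<And>z. z \<in> P \<Longrightarrow> norm z \<le> B" using assms(1) bounded_iff by blast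
  \<comment> \<open>Chosen so that \<open>norm (t *\<^sub>R r)\<close> equals
    \<open>B + norm x + 1\<close>, beyond what the triangle inequality permits.\<close>
  define t where "t = (B + norm x + 1) / norm r"
  have "norm x \<le> B" using B[OF assms(2)[of 0]] by simp
  then have "0 \<le> B" using norm_ge_zero[of x] by linarith
  then have "0 \<le> t" unfolding t_def by simp
  have "norm (t *\<^sub>R r) \<le> norm (x + t *\<^sub>R r) + norm x"
    using norm_triangle_ineq4[of "x + t *\<^sub>R r" x] by simp
  also have "\<dots> \<le> B + norm x" using B assms(2) \<open>0 \<le> t\<close> by simp
  finally show False using \<open>r \<noteq> 0\<close> \<open>0 \<le> t\<close> by (simp add: t_def)
qed

text \<open>The vertices of \<open>S\<close> are packed greedily below \<open>y\<close>; \<open>\<Delta>\<close> is the mass of \<open>x\<close> that does not fit.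
  Each vertex that does not fit completely is blocked by a tight coordinate, so \<open>card S\<close> coordinates
  of \<open>x - y\<close> account for all of \<open>\<Delta>\<close>.\<close>

lemma exchange_decomposition:
  fixes A :: "real^'n^'m" and b :: "real^'m" and S P :: "(real^'n) set"
  assumes P: "P = {x. (\<forall>j. 0 \<le> x $ j) \<and> A *v x = b}" and "bounded P"
    and S: "finite S" "S \<subseteq> P" "\<And>u j. u \<in> S \<Longrightarrow> u $ j \<in> {0, 1}"
    and x: "x \<in> convex hull S" and y: "y \<in> P" and "y \<noteq> x"
  shows "\<exists>\<Delta> z z'. 0 < \<Delta> \<and> \<Delta>\<^sup>2 \<le> card S * (norm (y - x))\<^sup>2 \<and> z \<in> P \<and> z' \<in> P \<and>
    (\<forall>j. y $ j = 0 \<longrightarrow> z' $ j = 0) \<and> y - x = \<Delta> *\<^sub>R (z' - z)"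
proof -
  obtain \<rho> where \<rho>: "\<And>u. u \<in> S \<Longrightarrow> 0 \<le> \<rho> u" "sum \<rho> S = 1" "(\<Sum>u\<in>S. \<rho> u *\<^sub>R u) = x"
    using x unfolding convex_hull_finite[OF S(1)] by auto
  have y0: "0 \<le> y $ j" for j using y P by auto
  have "\<exists>\<nu>. (\<forall>u\<in>S. 0 \<le> \<nu> u \<and> \<nu> u \<le> \<rho> u) \<and> (\<forall>j. (\<Sum>u\<in>S. \<nu> u * u $ j) \<le> y $ j) \<and>
    (\<forall>u\<in>S. \<nu> u < \<rho> u \<longrightarrow> (\<exists>j. u $ j = 1 \<and> (\<Sum>u\<in>S. \<nu> u * u $ j) = y $ j))"
    using S(1) \<rho>(1) S(3) y0 by (rule greedy_packing)
  then obtain \<nu> where packing: "\<forall>u\<in>S. 0 \<le> \<nu> u \<and> \<nu> u \<le> \<rho> u" "\<forall>j. (\<Sum>u\<in>S. \<nu> u * u $ j) \<le> y $ j"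
    "\<forall>u\<in>S. \<nu> u < \<rho> u \<longrightarrow> (\<exists>j. u $ j = 1 \<and> (\<Sum>u\<in>S. \<nu> u * u $ j) = y $ j)"
    by (elim exE conjE)
  have \<nu>: "0 \<le> \<nu> u" "\<nu> u \<le> \<rho> u" if "u \<in> S" for u using packing(1) that by auto
  define c where "c = (\<Sum>u\<in>S. \<nu> u *\<^sub>R u)"
  define \<Delta> where "\<Delta> = (\<Sum>u\<in>S. \<rho> u - \<nu> u)"
  have \<Delta>: "\<Delta> = 1 - sum \<nu> S" by (simp add: \<Delta>_def sum_subtractf \<rho>(2))
  have c: "c $ j = (\<Sum>u\<in>S. \<nu> u * u $ j)" for j by (simp add: c_def)
  have x_c: "(x - c) $ j = (\<Sum>u\<in>S. (\<rho> u - \<nu> u) * u $ j)" for j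
    by (simp add: c_def \<rho>(3)[symmetric] left_diff_distrib sum_subtractf)
  have S0: "0 \<le> u $ j" if "u \<in> S" for u j using S(3)[OF that, of j] by auto
  have Au: "A *v u = b" if "u \<in> S" for u using that S(2) P by auto
  have "A *v c = (\<Sum>u\<in>S. \<nu> u *\<^sub>R b)"
    unfolding c_def using Au
    by (simp add: linear_sum[OF matrix_vector_mul_linear] matrix_vector_mult_scaleR)
  then have Ac: "A *v c = sum \<nu> S *\<^sub>R b" by (simp add: scaleR_sum_left)
  have "A *v x = (\<Sum>u\<in>S. \<rho> u *\<^sub>R b)"
    unfolding \<rho>(3)[symmetric] using Au
    by (simp add: linear_sum[OF matrix_vector_mul_linear] matrix_vector_mult_scaleR)
  then have Ax: "A *v x = b" using \<rho>(2) by (simp flip: scaleR_sum_left)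
  have Ay: "A *v y = b" using y P by auto
  have Axc: "A *v (x - c) = \<Delta> *\<^sub>R b" and Ayc: "A *v (y - c) = \<Delta> *\<^sub>R b"
    by (simp_all add: matrix_vector_mult_diff_distrib Ax Ay Ac \<Delta> scaleR_left_diff_distrib)
  have xc0: "0 \<le> (x - c) $ j" for j
    unfolding x_c using \<nu>(2) S0 by (intro sum_nonneg) simp
  have yc0: "0 \<le> (y - c) $ j" for j using packing(2) by (simp add: c)
  have c0: "0 \<le> c $ j" for j unfolding c using \<nu>(1) S0 by (intro sum_nonneg) simp
  have "0 \<le> \<Delta>" unfolding \<Delta>_def using \<nu>(2) by (intro sum_nonneg) simp
  \<comment> \<open>If all mass fits, then \<open>x = c\<close> lies below \<open>y\<close> in every
    coordinate and \<open>A\<close> vanishes on \<open>y - x\<close>, so the whole ray from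
    \<open>x\<close> through \<open>y\<close> stays in \<open>P\<close>, against
    boundedness.\<close>
  have "\<Delta> \<noteq> 0"
  proof
    assume "\<Delta> = 0"
    then have "\<And>u. u \<in> S \<Longrightarrow> \<rho> u - \<nu> u = 0"
      unfolding \<Delta>_def using \<nu>(2) S(1) by (subst (asm) sum_nonneg_eq_0_iff) auto
    then have "x - c = 0" by (simp add: vec_eq_iff x_c del: vector_minus_component)
    then have "x = c" by simp
    have "x + t *\<^sub>R (y - x) \<in> P" if "0 \<le> t" for t
      using that xc0 yc0 c0 \<open>\<Delta> = 0\<close> Ayc Ax unfolding P \<open>x = c\<close>
      by (auto simp: matrix_vector_right_distrib matrix_vector_mult_scaleR)
    from bounded_no_nonneg_ray[OF \<open>bounded P\<close> this] show False using \<open>y \<noteq> x\<close> by simp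
  qed
  with \<open>0 \<le> \<Delta>\<close> have "0 < \<Delta>" by simp
  \<comment> \<open>The leftovers \<open>x - c\<close> and \<open>y - c\<close> are nonnegative and
    both are mapped to \<open>\<Delta> *\<^sub>R b\<close>; rescaling puts them into
    \<open>P\<close>.\<close>
  define z z' where "z = (1/\<Delta>) *\<^sub>R (x - c)" and "z' = (1/\<Delta>) *\<^sub>R (y - c)"
  have "z \<in> P" "z' \<in> P"
    using \<open>0 < \<Delta>\<close> Axc Ayc xc0 yc0 unfolding P z_def z'_def
    by (auto simp: matrix_vector_mult_scaleR)
  moreover have "z' $ j = 0" if "y $ j = 0" for j
    using yc0[of j] c0[of j] that by (simp add: z'_def)
  moreover have "y - x = \<Delta> *\<^sub>R (z' - z)"
    using \<open>0 < \<Delta>\<close> by (simp add: z_def z'_def flip: scaleR_diff_right)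
  moreover have "\<Delta>\<^sup>2 \<le> card S * (norm (y - x))\<^sup>2"
  proof -
    define T where "T = {u \<in> S. \<nu> u < \<rho> u}"
    have "\<forall>u\<in>T. \<exists>j. u $ j = 1 \<and> c $ j = y $ j" using packing(3) by (simp add: T_def c)
    \<comment> \<open>\<open>J\<close> assigns a tight coordinate to each blocked vertex. It may
      fail to be injective, so the sums below run over its image.\<close>
    then obtain J where "\<forall>u\<in>T. u $ J u = 1 \<and> c $ J u = y $ J u" by (rule bchoice[THEN exE])
    then have J: "u $ J u = 1" "c $ J u = y $ J u" if "u \<in> T" for u using that by auto
    have "finite T" using S(1) by (simp add: T_def)
    have "\<Delta> = (\<Sum>u\<in>T. \<rho> u - \<nu> u)"
      unfolding \<Delta>_def T_def using S(1) \<nu>(2) by (intro sum.mono_neutral_right) (auto simp: order_less_le)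
    also have "\<dots> \<le> (\<Sum>u\<in>T. \<Sum>j\<in>J ` T. (\<rho> u - \<nu> u) * u $ j)"
    proof (rule sum_mono)
      fix u assume u: "u \<in> T"
      have "(\<rho> u - \<nu> u) * u $ J u \<le> (\<Sum>j\<in>J ` T. (\<rho> u - \<nu> u) * u $ j)"
        using u S0 \<open>finite T\<close> by (intro member_le_sum) (auto simp: T_def)
      then show "\<rho> u - \<nu> u \<le> (\<Sum>j\<in>J ` T. (\<rho> u - \<nu> u) * u $ j)" using J[OF u] by simp
    qed
    also have "\<dots> \<le> (\<Sum>u\<in>S. \<Sum>j\<in>J ` T. (\<rho> u - \<nu> u) * u $ j)"
      using S(1) S0 \<nu>(2) by (intro sum_mono2 sum_nonneg) (auto simp: T_def)
    \<comment> \<open>On the tight coordinates \<open>c\<close> and \<open>y\<close> agree, so the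
      total is a sum of entries of \<open>x - y\<close>, to which Cauchy-Schwarz applies.\<close>
    also have "\<dots> = (\<Sum>j\<in>J ` T. (x - c) $ j)"
      unfolding x_c by (rule sum.swap)
    also have "\<dots> = (\<Sum>j\<in>J ` T. (x - y) $ j)"
      using J by (intro sum.cong) auto
    finally have "\<Delta>\<^sup>2 \<le> (\<Sum>j\<in>J ` T. (x - y) $ j)\<^sup>2" using \<open>0 \<le> \<Delta>\<close> by (intro power_mono)
    also have "\<dots> \<le> (\<Sum>j\<in>J ` T. ((x - y) $ j)\<^sup>2) * card (J ` T)"
      by (rule sum_squared_le_sum_of_squares)
    also have "\<dots> \<le> (norm (y - x))\<^sup>2 * card S"
    proof (rule mult_mono)
      have "(\<Sum>j\<in>J ` T. ((x - y) $ j)\<^sup>2) \<le> (\<Sum>j\<in>UNIV. ((x - y) $ j)\<^sup>2)"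
        by (intro sum_mono2) auto
      also have "\<dots> = (norm (x - y))\<^sup>2"
        unfolding power2_norm_eq_inner inner_vec_def by (simp add: power2_eq_square)
      finally show "(\<Sum>j\<in>J ` T. ((x - y) $ j)\<^sup>2) \<le> (norm (y - x))\<^sup>2"
        by (simp add: norm_minus_commute)
      have "card (J ` T) \<le> card T" using \<open>finite T\<close> by (rule card_image_le)
      also have "\<dots> \<le> card S" using S(1) by (intro card_mono) (auto simp: T_def)
      finally show "real (card (J ` T)) \<le> real (card S)" by simp
    qed auto
    finally show ?thesis by (simp add: mult.commute)
  qed
  ultimately show ?thesis using \<open>0 < \<Delta>\<close> by blast
qed

section \<open>Linear optimization with the masked gradient\<close>

lemma ext_inner_masked_supported:
  assumes "\<And>j. y $ j \<le> 0 \<Longrightarrow> v $ j = 0"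
  shows "ext_inner v (masked_gradient Q y) = ereal (v \<bullet> gradient Q y)"
proof -
  have "ereal (v $ j) * masked_gradient Q y $ j = ereal (v $ j * gradient Q y $ j)" for j
    using assms[of j] by (cases "y $ j > 0") (auto simp: masked_gradient_def)
  then show ?thesis by (simp add: ext_inner_def inner_vec_def)
qed

text \<open>No summand is positive infinity, so the one infinite penalty decides the sum.\<close>

lemma ext_inner_masked_unsupported:
  assumes "\<And>j. 0 \<le> v $ j" and "y $ k \<le> 0" "v $ k \<noteq> 0"
  shows "ext_inner v (masked_gradient Q y) = -\<infinity>"
proof -
  let ?t = "\<lambda>j. ereal (v $ j) * masked_gradient Q y $ j"
  have "0 < v $ k" using assms(1)[of k] assms(3) by simp
  then have k: "?t k = -\<infinity>" using assms(2) by (simp add: masked_gradient_def)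
  define r where "r = sum ?t (UNIV - {k})"
  have "?t j \<noteq> \<infinity>" for j
    using assms(1)[of j] by (cases "v $ j = 0") (auto simp: masked_gradient_def)
  then have r: "r \<noteq> \<infinity>" by (simp add: r_def sum_Pinfty)
  have "ext_inner v (masked_gradient Q y) = ?t k + r"
    unfolding ext_inner_def r_def by (rule sum.remove) auto
  also have "\<dots> = -\<infinity>" unfolding k using r by (cases r) auto
  finally show ?thesis .
qed

text \<open>A supported candidate \<open>v\<close> has a finite value. The maximizer does at least
  as well, so its value is not negative infinity and it is supported too; then both values are
  ordinary inner products.\<close>

lemma masked_arg_max:
  assumes max: "is_arg_max (\<lambda>w. ext_inner w (masked_gradient Q y)) (\<lambda>w. w \<in> V) w"
    and V: "\<And>v j. v \<in> V \<Longrightarrow> 0 \<le> v $ j"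
    and v: "v \<in> V" "\<And>j. y $ j \<le> 0 \<Longrightarrow> v $ j = 0"
  shows "w \<in> V" and "y $ j \<le> 0 \<Longrightarrow> w $ j = 0" and "v \<bullet> gradient Q y \<le> w \<bullet> gradient Q y"
proof -
  show w: "w \<in> V" using max by (simp add: is_arg_max_def)
  have le: "ereal (v \<bullet> gradient Q y) \<le> ext_inner w (masked_gradient Q y)"
    using max v(1) ext_inner_masked_supported[of y v Q, OF v(2)] by (auto simp: is_arg_max_def not_less)
  then have supp: "w $ j = 0" if "y $ j \<le> 0" for j
    using ext_inner_masked_unsupported[of w y j Q] V[OF w] that by fastforce
  then show "y $ j \<le> 0 \<Longrightarrow> w $ j = 0" .
  show "v \<bullet> gradient Q y \<le> w \<bullet> gradient Q y"
    using le ext_inner_masked_supported[of y w Q, OF supp] by simp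
qed

lemma convex_hull_inner_ge:
  assumes "z \<in> convex hull V" "\<And>v. v \<in> V \<Longrightarrow> m \<le> v \<bullet> g"
  shows "m \<le> z \<bullet> g"
proof -
  have "convex hull V \<subseteq> {z. m \<le> g \<bullet> z}"
    using assms(2) by (intro hull_minimal convex_halfspace_ge) (auto simp: inner_commute)
  then show ?thesis using assms(1) by (auto simp: inner_commute)
qed

text \<open>In a convex combination of nonnegative vectors, a zero coordinate forces a zero in every
  vector with nonzero weight. Hence a supported point combines supported vertices only.\<close>

lemma supported_convex_hull_inner_le:
  fixes V :: "(real^'n) set"
  assumes "finite V" and V: "\<And>v j. v \<in> V \<Longrightarrow> 0 \<le> v $ j"
    and z: "z \<in> convex hull V" "\<And>j. j \<in> J \<Longrightarrow> z $ j = 0"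
    and M: "\<And>v. v \<in> V \<Longrightarrow> (\<And>j. j \<in> J \<Longrightarrow> v $ j = 0) \<Longrightarrow> v \<bullet> g \<le> M"
  shows "\<exists>v\<in>V. \<forall>j\<in>J. v $ j = 0" and "z \<bullet> g \<le> M"
proof -
  obtain u where u: "\<And>v. v \<in> V \<Longrightarrow> 0 \<le> u v" "sum u V = 1" "(\<Sum>v\<in>V. u v *\<^sub>R v) = z"
    using z(1) unfolding convex_hull_finite[OF \<open>finite V\<close>] by auto
  have supp: "v $ j = 0" if "v \<in> V" "u v \<noteq> 0" "j \<in> J" for v j
  proof -
    have "(\<Sum>v\<in>V. u v * v $ j) = 0" using z(2)[OF that(3)] unfolding u(3)[symmetric] by simp
    then have "u v * v $ j = 0"
      using that(1) \<open>finite V\<close> u(1) V by (subst (asm) sum_nonneg_eq_0_iff) auto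
    then show ?thesis using that(2) by simp
  qed
  have "\<exists>v\<in>V. u v \<noteq> 0" using u(2) sum.neutral[of V u] by fastforce
  then show "\<exists>v\<in>V. \<forall>j\<in>J. v $ j = 0" using supp by blast
  have "z \<bullet> g = (\<Sum>v\<in>V. u v * (v \<bullet> g))" unfolding u(3)[symmetric] by (simp add: inner_sum_left)
  also have "\<dots> \<le> (\<Sum>v\<in>V. u v * M)"
  proof (rule sum_mono)
    fix v assume v: "v \<in> V"
    show "u v * (v \<bullet> g) \<le> u v * M"
      using u(1)[OF v] M[OF v] supp[OF v] by (cases "u v = 0") (auto intro!: mult_left_mono)
  qed
  also have "\<dots> = M" by (simp add: u(2) flip: sum_distrib_right)
  finally show "z \<bullet> g \<le> M" .
qed

section \<open>Faces, vertices and the scalar recursion\<close>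

text \<open>Caratheodory is applied inside the face, whose extreme points are also extreme in
  \<open>P\<close>; this brings in the dimension of the face instead of that of
  \<open>P\<close>.\<close>

lemma face_caratheodory:
  fixes P :: "'a::euclidean_space set"
  assumes "polytope P" "T face_of P" "x \<in> T"
  obtains S where "finite S" "S \<subseteq> vertices P" "int (card S) \<le> aff_dim T + 1" "x \<in> convex hull S"
proof -
  have "compact T" "convex T"
    using assms face_of_imp_compact face_of_imp_convex polytope_imp_compact polytope_imp_convex by blast+
  then have T: "T = convex hull {v. v extreme_point_of T}" by (rule Krein_Milman_Minkowski)
  then have dim: "aff_dim {v. v extreme_point_of T} = aff_dim T" using aff_dim_convex_hull by metis
  have "x \<in> convex hull {v. v extreme_point_of T}" using assms(3) T by blast
  then obtain S where S: "finite S" "S \<subseteq> {v. v extreme_point_of T}"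
    "int (card S) \<le> aff_dim T + 1" "x \<in> convex hull S"
    unfolding caratheodory_aff_dim[of "{v. v extreme_point_of T}"] dim by blast
  moreover have "S \<subseteq> vertices P"
    using S(2) assms(2) by (auto simp: vertices_def extreme_point_of_face)
  ultimately show ?thesis by (intro that)
qed

lemma one_le_norm_diff_binary:
  fixes u v :: "real^'n"
  assumes "\<And>j. u $ j \<in> {0, 1}" "\<And>j. v $ j \<in> {0, 1}" "u \<noteq> v"
  shows "1 \<le> norm (u - v)"
proof -
  obtain j where "u $ j \<noteq> v $ j" using assms(3) by (auto simp: vec_eq_iff)
  then have "\<bar>(u - v) $ j\<bar> = 1" using assms(1)[of j] assms(2)[of j] by auto
  then show ?thesis using component_le_norm_cart[of "u - v" j] by simp
qed

lemma not_extreme_symmetric_segment: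
  assumes "convex S" "x \<in> S" "\<not> x extreme_point_of S"
  obtains d where "d \<noteq> 0" "x - d \<in> S" "x + d \<in> S"
proof -
  obtain a b where ab: "a \<in> S" "b \<in> S" "x \<in> open_segment a b"
    using assms by (auto simp: extreme_point_of_def)
  then obtain u where u: "a \<noteq> b" "0 < u" "u < 1" "x = (1 - u) *\<^sub>R a + u *\<^sub>R b"
    by (auto simp: in_segment)
  \<comment> \<open>The smaller of the two barycentric weights is how far both directions can be
    followed.\<close>
  define t where "t = min u (1 - u)"
  have t: "0 < t" "t \<le> u" "t \<le> 1 - u" using u by (auto simp: t_def)
  have "(1 - (u + s)) *\<^sub>R a + (u + s) *\<^sub>R b = x + s *\<^sub>R (b - a)" for s
    by (simp add: u(4) algebra_simps)
  moreover have "(1 - (u + s)) *\<^sub>R a + (u + s) *\<^sub>R b \<in> S" if "-t \<le> s" "s \<le> t" for s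
    using that t ab u by (intro convexD[OF assms(1)]) auto
  ultimately have "x + s *\<^sub>R (b - a) \<in> S" if "-t \<le> s" "s \<le> t" for s using that by metis
  from this[of t] this[of "-t"] show ?thesis
    using that[of "t *\<^sub>R (b - a)"] t u(1) by simp
qed

text \<open>With \<open>a = c * H\<close> and \<open>w = lam\<^sup>2 * K\<close> it suffices that
  \<open>w + a \<le> lam * gap\<close>. Rounding the step to a power of two keeps \<open>w\<close>
  between \<open>a / 2\<close> and \<open>2 * a\<close>, where the square of \<open>w + a\<close> is
  at most \<open>9 / 2 * (a * w)\<close>. Since \<open>h\<close> is at least
  \<open>15 / 16 * H\<close>, the gap condition supplies \<open>15 / 2 * (a * w)\<close>.\<close>

lemma step_decrease:
  fixes c h H K \<gamma> lam gap :: real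
  assumes c: "0 < c" "c \<le> 1/16" and h: "(1 - c) * H < h" "h \<le> H" and "0 \<le> H"
    and \<gamma>: "\<gamma>\<^sup>2 * K = 2 * c * H" and lam: "0 \<le> lam" "lam \<le> \<gamma>" "\<gamma> \<le> 2 * lam"
    and "0 \<le> K" "0 \<le> gap" and gap: "8 * c * K * h \<le> gap\<^sup>2"
  shows "h - lam * gap + lam\<^sup>2 * K \<le> (1 - c) * H"
proof -
  define w where "w = lam\<^sup>2 * K"
  define a where "a = c * H"
  have a: "0 \<le> a" using c \<open>0 \<le> H\<close> by (simp add: a_def)
  have "lam\<^sup>2 * K \<le> \<gamma>\<^sup>2 * K" using lam \<open>0 \<le> K\<close> by (intro mult_right_mono power_mono) auto
  then have w2: "w \<le> 2 * a" using \<gamma> by (simp add: w_def a_def)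
  have "\<gamma>\<^sup>2 * K \<le> (2 * lam)\<^sup>2 * K" using lam \<open>0 \<le> K\<close> by (intro mult_right_mono power_mono) auto
  then have w1: "a / 2 \<le> w" using \<gamma> by (simp add: w_def a_def power_mult_distrib mult_ac)
  have "(w - a / 2) * (w - 2 * a) \<le> 0" using w1 w2 by (simp add: mult_le_0_iff)
  then have "(w + a)\<^sup>2 \<le> 9 / 2 * (a * w)" by (simp add: power2_eq_square algebra_simps)
  also have "\<dots> \<le> 15 / 2 * (a * w)" using a w1 by simp
  also have "\<dots> = 8 * (c * w) * (15 / 16 * H)" by (simp add: a_def)
  also have "\<dots> \<le> 8 * (c * w) * h"
  proof (rule mult_left_mono)
    have "c * H \<le> 1 / 16 * H" using c(2) \<open>0 \<le> H\<close> by (rule mult_right_mono)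
    then show "15 / 16 * H \<le> h" using h(1) by (simp add: algebra_simps)
  qed (use c a w1 in auto)
  also have "\<dots> = lam\<^sup>2 * (8 * c * K * h)" by (simp add: w_def)
  also have "\<dots> \<le> lam\<^sup>2 * gap\<^sup>2" using gap by (rule mult_left_mono) simp
  finally have "(w + a)\<^sup>2 \<le> (lam * gap)\<^sup>2" by (simp add: power_mult_distrib)
  then have "w + a \<le> lam * gap" by (rule power2_le_imp_le) (use lam \<open>0 \<le> gap\<close> in simp)
  then show ?thesis using h(2) by (simp add: w_def a_def algebra_simps)
qed

theorem theorem3:
  fixes A :: "real^'n^'m" and b :: "real^'m"
    and P Fstar :: "(real^'n) set"
    and f Q :: "real^'n \<Rightarrow> real"
    and F \<phi> :: "real^'n \<Rightarrow> ereal"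
    and \<alpha> \<beta> \<beta>\<^sub>2 \<beta>' D c\<^sub>1 nstar :: real
    and xstar x\<^sub>t :: "real^'n"
    and \<gamma> :: "nat \<Rightarrow> real"
    and y wp wm :: "nat \<Rightarrow> real^'n" and q :: "nat \<Rightarrow> nat"
  assumes P_eq: "P = {x. (\<forall>j. 0 \<le> x $ j) \<and> A *v x = b}"
    and P_polytope: "polytope P"
    and vertices_binary: "\<forall>v\<in>vertices P. \<forall>j. v $ j \<in> {0, 1}"
    and vertices_card: "card (vertices P) \<ge> 2"
    and f_convex: "convex_on P f"
    and f_C2: "twice_cont_diff_over P f"
    and hess_lipschitz:
      "\<forall>x\<in>P. \<forall>z\<in>P. onorm ((*v) (hessian f x - hessian f z)) \<le> \<beta>\<^sub>2 * norm (x - z)"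
    and grad_lipschitz: "\<forall>x\<in>P. \<forall>z\<in>P. norm (gradient f x - gradient f z) \<le> \<beta> * norm (x - z)"
    and D_eq: "D = diameter P"
    and F_eq: "F = (\<lambda>x. ereal (f x) + set_ind P x)"
    and unique_minimizer: "\<forall>x. is_arg_min F (\<lambda>_. True) x \<longleftrightarrow> x = xstar"
    and alpha_pos: "\<alpha> > 0"
    and quadratic_growth:
      "\<forall>x\<in>P. ereal ((norm (x - xstar))\<^sup>2) \<le> ereal (2 / \<alpha>) * (F x - (INF z. F z))"
    and Fstar_min_face: "is_arg_min aff_dim (\<lambda>T. T face_of P \<and> xstar \<in> T) Fstar"
    and nstar_eq: "nstar = real_of_int (aff_dim Fstar + 1)"
    and xt_in: "x\<^sub>t \<in> P"
    and Q_eq: "Q = cubic_model f \<beta>\<^sub>2 x\<^sub>t"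
    and phi_eq: "\<phi> = (\<lambda>w. ereal (Q w) + set_ind P w)"
    and beta'_eq: "\<beta>' = \<beta> + \<beta>\<^sub>2 * D / 2"
    and c1_eq: "c\<^sub>1 = \<alpha> / (32 * nstar * \<beta>' * D\<^sup>2)"
    and gamma_eq: "\<forall>i\<ge>1. \<gamma> i = sqrt c\<^sub>1 * sqrt ((1 - c\<^sub>1) ^ (i - 1))"
    and run: "dicg_run P Q x\<^sub>t \<gamma> y wp wm q"
  shows "(\<forall>i\<ge>1. y i \<in> P) \<and>
    (\<forall>i\<ge>1. \<phi> (y i) - \<phi> xstar \<le>
       ereal (max (\<beta>' * D\<^sup>2 / 2 * (1 - \<alpha> / (32 * nstar * \<beta>' * D\<^sup>2)) ^ (i - 1))
                  (\<beta>\<^sub>2 / 3 * norm (x\<^sub>t - xstar) ^ 3)))"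
proof -

  \<comment> \<open>Geometry of the polytope, signs of the constants and quadratic growth\<close>
  define V where "V = vertices P"
  have "finite V" using vertices_card by (intro card_ge_0_finite) (simp add: V_def)
  have convexP: "convex P" and compactP: "compact P" and boundedP: "bounded P"
    using P_polytope polytope_imp_convex polytope_imp_compact polytope_imp_bounded by auto
  have hullV: "P = convex hull V"
    unfolding V_def vertices_def using compactP convexP by (rule Krein_Milman_Minkowski)
  have VP: "v \<in> P" if "v \<in> V" for v using that by (simp add: V_def vertices_def extreme_point_of_def)
  have V01: "v $ j \<in> {0, 1}" if "v \<in> V" for v j using that vertices_binary by (auto simp: V_def)
  have V0: "0 \<le> v $ j" if "v \<in> V" for v j using V01[OF that, of j] by auto
  interpret lipschitz_hessian P f \<beta>\<^sub>2
    using f_C2 hess_lipschitz convexP unfolding twice_cont_diff_over_def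
    by unfold_locales blast+
  have grad: "norm (gradient f x - gradient f z) \<le> \<beta> * norm (x - z)" if "x \<in> P" "z \<in> P" for x z
    using grad_lipschitz that by blast
  have diam: "norm (x - z) \<le> D" if "x \<in> P" "z \<in> P" for x z
    using diameter_bounded_bound[OF boundedP that] by (simp add: D_eq dist_norm)

  \<comment> \<open>Two distinct binary vertices force \<open>1 \<le> D\<close>, and the Lipschitz
    conditions at this pair force \<open>\<beta>\<^sub>2\<close> and \<beta> to be
    nonnegative.\<close>
  obtain v1 v2 where v12: "v1 \<in> V" "v2 \<in> V" "v1 \<noteq> v2"
    using vertices_card unfolding V_def[symmetric] by (meson card_2_iff' obtain_subset_with_card_n subsetD)
  then have v12_norm: "1 \<le> norm (v1 - v2)" using V01 by (intro one_le_norm_diff_binary) auto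
  then have D1: "1 \<le> D" using diam[OF VP VP, OF v12(1,2)] by simp
  have "0 \<le> \<beta>\<^sub>2 * norm (v1 - v2)"
    using hess_lip[OF VP VP, OF v12(1,2)] onorm_pos_le[OF matrix_vector_mul_bounded_linear] order_trans by blast
  then have \<beta>2: "0 \<le> \<beta>\<^sub>2" using v12(3) by (simp add: zero_le_mult_iff)
  have "0 \<le> \<beta> * norm (v1 - v2)"
    using grad[OF VP VP, OF v12(1,2)] norm_ge_zero order_trans by blast
  then have \<beta>: "0 \<le> \<beta>" using v12(3) by (simp add: zero_le_mult_iff)

  have F_min: "F xstar \<le> F z" for z
    using unique_minimizer by (auto simp: is_arg_min_def not_less)
  have xs: "xstar \<in> P" using F_min[of x\<^sub>t] xt_in by (auto simp: F_eq set_ind_def split: if_splits)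
  have inf: "(INF z. F z) = F xstar" using F_min by (intro antisym INF_greatest INF_lower) auto
  have growth: "\<alpha> * (norm (x - xstar))\<^sup>2 \<le> 2 * (f x - f xstar)" if "x \<in> P" for x
  proof -
    have F: "F x = ereal (f x)" "F xstar = ereal (f xstar)" using that xs by (simp_all add: F_eq set_ind_def)
    show ?thesis using quadratic_growth[rule_format, OF that] alpha_pos unfolding inf F
      by (simp add: field_simps)
  qed

  \<comment> \<open>The run, feasibility of its iterates and monotonicity of the gap\<close>
  have run_props:
    "is_arg_min (\<lambda>w. w \<bullet> gradient Q x\<^sub>t) (\<lambda>w. w \<in> V) (y 1)"
    "\<And>i. 1 \<le> i \<Longrightarrow> is_arg_min (\<lambda>w. w \<bullet> gradient Q (y i)) (\<lambda>w. w \<in> V) (wp i)"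
    "\<And>i. 1 \<le> i \<Longrightarrow> is_arg_max (\<lambda>w. ext_inner w (masked_gradient Q (y i))) (\<lambda>w. w \<in> V) (wm i)"
    "\<And>i. 1 \<le> i \<Longrightarrow> \<gamma> i \<le> 1"
    "\<And>i. 1 \<le> i \<Longrightarrow> (1/2) ^ q i \<le> \<gamma> i"
    "\<And>i k. 1 \<le> i \<Longrightarrow> (1/2) ^ k \<le> \<gamma> i \<Longrightarrow> q i \<le> k"
    using run unfolding dicg_run_def V_def by blast+
  define lam where "lam i = (1/2 :: real) ^ q i" for i
  define z where "z i = y i + lam i *\<^sub>R (wp i - wm i)" for i
  have y_Suc: "y (Suc i) = (if \<phi> (z i) < \<phi> (y i) then z i else y i)" if "1 \<le> i" for i
    using run that unfolding dicg_run_def phi_eq z_def lam_def by (simp add: Let_def)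
  have phi_P: "\<phi> w = ereal (Q w)" if "w \<in> P" for w using that by (simp add: phi_eq set_ind_def)
  have phi_notP: "\<phi> w = \<infinity>" if "w \<notin> P" for w using that by (simp add: phi_eq set_ind_def)
  have y1V: "y 1 \<in> V" using run_props(1) by (simp add: is_arg_min_def)
  have yP: "y i \<in> P" if "1 \<le> i" for i
    using that
  proof (induction i rule: nat_induct_at_least)
    case base then show ?case using y1V VP by simp
  next
    case (Suc i)
    \<comment> \<open>An infeasible candidate has infinite value and is never accepted. That
      candidates are in fact feasible is shown in \<open>zP\<close> and serves the decrease.\<close>
    have "z i \<in> P" if "\<phi> (z i) < \<phi> (y i)" using that phi_notP[of "z i"] by force
    then show ?case using y_Suc[OF Suc(1)] Suc(2) by (auto split: if_splits)
  qed
  define h where "h i = Q (y i) - Q xstar" for i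
  have h_mono: "h (Suc i) \<le> h i" if "1 \<le> i" for i
    using y_Suc[OF that] yP[OF that] yP[of "Suc i"] phi_P by (auto simp: h_def split: if_splits)
  have h_z: "h (Suc i) \<le> Q (z i) - Q xstar" if "1 \<le> i" "z i \<in> P" for i
    using y_Suc[OF that(1)] yP[OF that(1)] phi_P that(2) by (auto simp: h_def)

  define K where "K = \<beta>' * D\<^sup>2"
  define B where "B = \<beta>\<^sub>2 / 3 * norm (x\<^sub>t - xstar) ^ 3"
  have B0: "0 \<le> B" using \<beta>2 by (simp add: B_def)
  have face: "Fstar face_of P" "xstar \<in> Fstar" using Fstar_min_face by (auto simp: is_arg_min_def)
  have "\<not> aff_dim Fstar < 0" using face(2) unfolding aff_dim_negative_iff by blast
  then have n1: "1 \<le> nstar" unfolding nstar_eq of_int_1_le_iff by linarith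
  \<comment> \<open>A power of 1/2 lies below each step size, so step sizes are positive; index 1
    then gives \<open>0 < c\<^sub>1\<close>, index 2 gives \<open>c\<^sub>1 < 1\<close>, and
    positivity of \<open>K\<close> follows.\<close>
  have \<gamma>_pos: "0 < \<gamma> i" if "1 \<le> i" for i
    using run_props(5)[OF that] less_le_trans[of 0 "(1/2) ^ q i" "\<gamma> i"] by simp
  have c1_pos: "0 < c\<^sub>1" using \<gamma>_pos[of 1] gamma_eq by simp
  have c1_less: "c\<^sub>1 < 1" using \<gamma>_pos[of 2] gamma_eq c1_pos by (simp add: zero_less_mult_iff)
  have c1_K: "c\<^sub>1 = \<alpha> / (32 * nstar * K)" by (simp add: c1_eq K_def mult.assoc)
  have K_pos: "0 < K" using c1_pos alpha_pos n1 unfolding c1_K by (simp add: zero_less_divide_iff zero_less_mult_iff)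
  have \<alpha>_c1: "\<alpha> = 32 * nstar * c\<^sub>1 * K" using K_pos n1 by (simp add: c1_K)
  have \<gamma>2: "(\<gamma> i)\<^sup>2 = c\<^sub>1 * (1 - c\<^sub>1) ^ (i - 1)" if "1 \<le> i" for i
    using gamma_eq that c1_pos c1_less by (simp add: power_mult_distrib)
  have \<gamma>_decr: "\<gamma> (Suc i) \<le> \<gamma> i" if "1 \<le> i" for i
  proof -
    have "(1 - c\<^sub>1) ^ (Suc i - 1) \<le> (1 - c\<^sub>1) ^ (i - 1)"
      using c1_pos c1_less by (intro power_decreasing) auto
    then show ?thesis using gamma_eq that c1_pos by (auto intro!: mult_left_mono)
  qed

  \<comment> \<open>Model error, oracle properties and the initial gap\<close>
  have error: "f w - f xstar \<le> Q w - Q xstar + B" if "w \<in> P" for w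
    using cubic_model_error(1)[OF xt_in that] cubic_model_error(2)[OF xt_in xs]
    by (simp add: Q_eq B_def norm_minus_commute)
  have tangent: "Q w + (x - w) \<bullet> gradient Q w \<le> Q x" if "w \<in> P" "x \<in> P" for w x
    unfolding Q_eq using cubic_model_tangent[OF f_convex grad \<beta>2 xt_in that] .
  have wp_min: "wp i \<in> V" "x \<in> P \<Longrightarrow> wp i \<bullet> gradient Q (y i) \<le> x \<bullet> gradient Q (y i)" if "1 \<le> i" for i x
    using run_props(2)[OF that] convex_hull_inner_ge[of x V] hullV by (auto simp: is_arg_min_def not_less)
  have wm_max: "wm i \<in> V" "y i $ j = 0 \<Longrightarrow> wm i $ j = 0"
      "x \<in> P \<Longrightarrow> (\<And>j. y i $ j = 0 \<Longrightarrow> x $ j = 0) \<Longrightarrow> x \<bullet> gradient Q (y i) \<le> wm i \<bullet> gradient Q (y i)"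
    if i: "1 \<le> i" for i j x
  proof -
    let ?J = "{j. y i $ j \<le> 0}"
    have J: "y i $ j \<le> 0 \<longleftrightarrow> y i $ j = 0" for j using yP[OF i] unfolding P_eq by (auto intro: antisym)
    note max = masked_arg_max[OF run_props(3)[OF i] V0]
    \<comment> \<open>The zero objective and the bound 0 make the bound condition trivial; what is
      wanted is a vertex supported where \<open>y i\<close> is.\<close>
    obtain v where "v \<in> V" "\<forall>j\<in>?J. v $ j = 0"
      using supported_convex_hull_inner_le(1)[OF \<open>finite V\<close> V0, of "y i" ?J 0 0] yP[OF i] hullV J by auto
    with max[of v] J show "wm i \<in> V" "y i $ j = 0 \<Longrightarrow> wm i $ j = 0" by auto
    show "x \<bullet> gradient Q (y i) \<le> wm i \<bullet> gradient Q (y i)"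
      if "x \<in> P" "\<And>j. y i $ j = 0 \<Longrightarrow> x $ j = 0"
      using that max(3) hullV J
      by (intro supported_convex_hull_inner_le(2)[OF \<open>finite V\<close> V0, of x ?J]) auto
  qed

  have h1: "h 1 \<le> K / 2"
  proof -
    let ?u = "y 1 - x\<^sub>t"
    have g: "gradient Q x\<^sub>t = gradient f x\<^sub>t" unfolding Q_eq by (rule gradient_cubic_model_center)
    have "y 1 \<bullet> gradient Q x\<^sub>t \<le> xstar \<bullet> gradient Q x\<^sub>t"
      using run_props(1) convex_hull_inner_ge[of xstar V] xs hullV by (auto simp: is_arg_min_def not_less)
    moreover have "Q x\<^sub>t = 0" by (simp add: Q_eq cubic_model_def)
    moreover have "Q (y 1) \<le> ?u \<bullet> gradient f x\<^sub>t + \<beta> / 2 * (norm ?u)\<^sup>2 + \<beta>\<^sub>2 / 6 * norm ?u ^ 3"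
      unfolding Q_eq using xt_in yP by (intro cubic_model_upper[OF grad]) auto
    moreover have "norm ?u \<le> D" using diam yP xt_in by simp
    then have "\<beta> / 2 * (norm ?u)\<^sup>2 + \<beta>\<^sub>2 / 6 * norm ?u ^ 3 \<le> \<beta> / 2 * D\<^sup>2 + \<beta>\<^sub>2 / 6 * D ^ 3"
      using \<beta> \<beta>2 by (intro add_mono mult_left_mono power_mono) auto
    ultimately have "h 1 \<le> \<beta> / 2 * D\<^sup>2 + \<beta>\<^sub>2 / 6 * D ^ 3"
      using tangent[OF xt_in xs] by (simp add: h_def g inner_diff_left)
    \<comment> \<open>Enlarging 1/6 to 1/4 produces exactly half of
      \<open>\<beta>' * D\<^sup>2\<close>.\<close>
    also have "\<dots> \<le> \<beta> / 2 * D\<^sup>2 + \<beta>\<^sub>2 / 4 * D ^ 3"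
      using \<beta>2 D1 by (intro add_left_mono mult_right_mono) auto
    also have "\<dots> = K / 2"
      by (simp add: K_def beta'_eq power2_eq_square power3_eq_cube algebra_simps)
    finally show ?thesis .
  qed

  \<comment> \<open>If \<open>xstar\<close> is a vertex, the first iterate is another vertex, at distance at least 1; otherwise a
    segment centred at \<open>xstar\<close> lies in \<open>P\<close>, and growth along it is limited by the Lipschitz gradient.\<close>
  have c1_small: "c\<^sub>1 \<le> 1/16" if "B < h 1"
  proof -
    have "\<alpha> \<le> 2 * K"
    proof (cases "xstar \<in> V")
      case True
      have "y 1 \<noteq> xstar" using that B0 by (auto simp: h_def)
      then have "1 \<le> norm (y 1 - xstar)" using V01 True y1V by (intro one_le_norm_diff_binary) auto
      then have "\<alpha> * 1 \<le> \<alpha> * (norm (y 1 - xstar))\<^sup>2" using alpha_pos by (intro mult_left_mono) auto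
      also have "\<dots> \<le> 2 * (f (y 1) - f xstar)" using growth yP by simp
      also have "\<dots> \<le> 4 * h 1" using error[of "y 1"] yP that by (simp add: h_def)
      finally show ?thesis using h1 by simp
    next
      case False
      then obtain d where d: "d \<noteq> 0" "xstar - d \<in> P" "xstar + d \<in> P"
        using not_extreme_symmetric_segment[OF convexP xs] unfolding V_def vertices_def by blast
      have "\<alpha> * (norm d)\<^sup>2 \<le> f (xstar + d) + f (xstar - d) - 2 * f xstar"
        using growth[OF d(2)] growth[OF d(3)] by simp
      also have "\<dots> \<le> 2 * \<beta> * (norm d)\<^sup>2"
        using symmetric_second_difference_le[OF grad \<beta> d(2,3)] .
      finally have "\<alpha> \<le> 2 * \<beta>" using d(1) by simp
      also have "\<dots> \<le> 2 * \<beta>'" using \<beta>2 D1 by (simp add: beta'_eq)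
      also have "\<dots> \<le> 2 * K"
        using \<beta> \<beta>2 D1 mult_left_mono[of 1 "D\<^sup>2" \<beta>'] by (simp add: K_def beta'_eq)
      finally show ?thesis .
    qed
    also have "\<dots> \<le> 2 * K * nstar" using K_pos n1 by simp
    finally show ?thesis using K_pos n1 by (simp add: c1_K divide_simps)
  qed

  \<comment> \<open>Feasibility of the dyadic steps\<close>
  have q_mono: "q i \<le> q (Suc i)" if "1 \<le> i" for i
    using run_props(5)[of "Suc i"] \<gamma>_decr[OF that] run_props(6)[OF that, of "q (Suc i)"] by simp
  \<comment> \<open>The first iterate is binary, each step moves along the current dyadic grid, and
    since \<open>q\<close> never decreases, later grids refine earlier ones.\<close>
  have grid: "y i $ j * 2 ^ q i \<in> \<int>" if "1 \<le> i" for i j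
    using that
  proof (induction i rule: nat_induct_at_least)
    case base
    show ?case using V01[OF y1V, of j] by auto
  next
    case (Suc i)
    have w: "wp i $ j \<in> \<int>" "wm i $ j \<in> \<int>"
      using V01[OF wp_min(1)[OF Suc(1)], of j] V01[OF wm_max(1)[OF Suc(1)], of j] by auto
    have "z i $ j * 2 ^ q i = y i $ j * 2 ^ q i + (wp i $ j - wm i $ j)"
      by (simp add: z_def lam_def power_divide algebra_simps)
    then have "z i $ j * 2 ^ q i \<in> \<int>" using Suc(2) w by simp
    then have "y (Suc i) $ j * 2 ^ q i \<in> \<int>" using y_Suc[OF Suc(1)] Suc(2) by simp
    then have "y (Suc i) $ j * 2 ^ q i * 2 ^ (q (Suc i) - q i) \<in> \<int>"
      by (rule Ints_mult) (intro Ints_power Ints_numeral)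
    then show ?case using q_mono[OF Suc(1)] by (simp add: mult.assoc flip: power_add)
  qed
  have zP: "z i \<in> P" if i: "1 \<le> i" for i
  proof -
    \<comment> \<open>Where \<open>y i\<close> vanishes so does \<open>wm i\<close>; elsewhere the
      grid gives a coordinate of at least \<open>lam i\<close>, enough to subtract
      \<open>lam i\<close> times a binary entry.\<close>
    have "0 \<le> z i $ j" for j
    proof (cases "y i $ j = 0")
      case True
      then show ?thesis using wm_max(2)[OF i] V0[OF wp_min(1)[OF i], of j] by (simp add: z_def lam_def)
    next
      case False
      then have "0 < y i $ j" using yP[OF i] unfolding P_eq by (auto simp: less_le)
      then have "1 \<le> \<bar>y i $ j * 2 ^ q i\<bar>" by (intro Ints_nonzero_abs_ge1 grid[OF i]) auto
      then have "lam i \<le> y i $ j" using \<open>0 < y i $ j\<close> by (simp add: lam_def power_divide field_simps)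
      moreover have "lam i * wm i $ j \<le> lam i * 1" "0 \<le> lam i * wp i $ j"
        using V01[OF wm_max(1)[OF i], of j] V0[OF wp_min(1)[OF i], of j] by (auto simp: lam_def)
      ultimately show ?thesis by (simp add: z_def algebra_simps)
    qed
    moreover have "A *v z i = b"
      using yP[OF i] VP[OF wp_min(1)[OF i]] VP[OF wm_max(1)[OF i]] unfolding P_eq z_def
      by (simp add: matrix_vector_right_distrib matrix_vector_mult_scaleR matrix_vector_mult_diff_distrib)
    ultimately show ?thesis by (simp add: P_eq)
  qed

  \<comment> \<open>Slope of the pairwise direction and decrease per step\<close>
  obtain S where S: "finite S" "S \<subseteq> V" "int (card S) \<le> aff_dim Fstar + 1" "xstar \<in> convex hull S"
    using face_caratheodory[OF P_polytope face] unfolding V_def by blast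
  have card_S: "real (card S) \<le> nstar" using S(3) unfolding nstar_eq by linarith
  have gap: "8 * c\<^sub>1 * K * h i \<le> ((wm i - wp i) \<bullet> gradient Q (y i))\<^sup>2"
      "0 \<le> (wm i - wp i) \<bullet> gradient Q (y i)" if i: "1 \<le> i" and big: "B < h i" for i
  proof -
    let ?g = "gradient Q (y i)"
    let ?gap = "(wm i - wp i) \<bullet> ?g"
    have h_pos: "0 < h i" using big B0 by simp
    then have "y i \<noteq> xstar" by (auto simp: h_def)
    have SP: "S \<subseteq> P" using S(2) VP by blast
    have "\<exists>\<Delta> x x'. 0 < \<Delta> \<and> \<Delta>\<^sup>2 \<le> card S * (norm (y i - xstar))\<^sup>2 \<and> x \<in> P \<and> x' \<in> P \<and>
        (\<forall>j. y i $ j = 0 \<longrightarrow> x' $ j = 0) \<and> y i - xstar = \<Delta> *\<^sub>R (x' - x)"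
      by (rule exchange_decomposition[OF P_eq boundedP S(1) SP _ S(4) yP[OF i] \<open>y i \<noteq> xstar\<close>])
        (use S(2) V01 in blast)
    then obtain \<Delta> x x' where \<Delta>: "0 < \<Delta>" "\<Delta>\<^sup>2 \<le> card S * (norm (y i - xstar))\<^sup>2" "x \<in> P" "x' \<in> P"
        "\<forall>j. y i $ j = 0 \<longrightarrow> x' $ j = 0" "y i - xstar = \<Delta> *\<^sub>R (x' - x)"
      by (elim exE conjE)
    have "h i \<le> (y i - xstar) \<bullet> ?g"
      using tangent[OF yP[OF i] xs] by (simp add: h_def inner_diff_left)
    also have "\<dots> = \<Delta> * (x' \<bullet> ?g - x \<bullet> ?g)" by (simp add: \<Delta>(6) inner_diff_left)
    also have "\<dots> \<le> \<Delta> * ?gap"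
      using wm_max(3)[OF i \<Delta>(4)] \<Delta>(5) wp_min(2)[OF i \<Delta>(3)] \<Delta>(1)
      by (intro mult_left_mono) (auto simp: inner_diff_left)
    finally have le: "h i \<le> \<Delta> * ?gap" .
    then show "0 \<le> ?gap" using h_pos \<Delta>(1) by (smt (verit) mult_pos_neg)
    \<comment> \<open>The model error costs at most \<open>B\<close>, which is below
      \<open>h i\<close>, so it only doubles the factor 2 from quadratic growth.\<close>
    have growth_i: "\<alpha> * (norm (y i - xstar))\<^sup>2 \<le> 4 * h i"
      using growth[OF yP[OF i]] error[OF yP[OF i]] big by (simp add: h_def)
    have "\<alpha> * \<Delta>\<^sup>2 \<le> \<alpha> * (nstar * (norm (y i - xstar))\<^sup>2)"
      using alpha_pos order_trans[OF \<Delta>(2) mult_right_mono[OF card_S]] by (intro mult_left_mono) auto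
    also have "\<dots> = nstar * (\<alpha> * (norm (y i - xstar))\<^sup>2)" by simp
    also have "\<dots> \<le> nstar * (4 * h i)" using growth_i n1 by (intro mult_left_mono) auto
    finally have "\<alpha> * \<Delta>\<^sup>2 \<le> nstar * (4 * h i)" .
    \<comment> \<open>Here \<open>\<alpha> = 32 * nstar * c\<^sub>1 * K\<close>, and division by 4
      leaves the constant 8.\<close>
    then have "(8 * c\<^sub>1 * K * \<Delta>\<^sup>2) * nstar \<le> h i * nstar" by (simp add: \<alpha>_c1 mult_ac)
    then have \<Delta>_le: "8 * c\<^sub>1 * K * \<Delta>\<^sup>2 \<le> h i" using n1 by simp
    have "(h i)\<^sup>2 \<le> (\<Delta> * ?gap)\<^sup>2" using le h_pos by (intro power_mono) auto
    then have "8 * c\<^sub>1 * K * (h i)\<^sup>2 \<le> 8 * c\<^sub>1 * K * (\<Delta> * ?gap)\<^sup>2"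
      using c1_pos K_pos by (intro mult_left_mono) auto
    also have "\<dots> = (8 * c\<^sub>1 * K * \<Delta>\<^sup>2) * ?gap\<^sup>2" by (simp add: power_mult_distrib)
    also have "\<dots> \<le> h i * ?gap\<^sup>2" using \<Delta>_le by (rule mult_right_mono) simp
    finally have "h i * (8 * c\<^sub>1 * K * h i) \<le> h i * ?gap\<^sup>2" by (simp add: power2_eq_square mult_ac)
    then show "8 * c\<^sub>1 * K * h i \<le> ?gap\<^sup>2" using h_pos by simp
  qed

  \<comment> \<open>On \<open>P\<close> the curvature of \<open>Q\<close> is only bounded by \<open>\<beta> + \<beta>\<^sub>2 * D\<close>, which may exceed \<open>\<beta>'\<close> but not
    \<open>2 * \<beta>'\<close>; \<open>step_decrease\<close> has room for this factor 2.\<close>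
  have descent: "Q (z i) - Q xstar \<le> h i - lam i * ((wm i - wp i) \<bullet> gradient Q (y i)) + (lam i)\<^sup>2 * K"
    if i: "1 \<le> i" for i
  proof -
    have w: "wp i \<in> P" "wm i \<in> P" using VP wp_min(1)[OF i] wm_max(1)[OF i] by auto
    let ?d = "wp i - wm i"
    have "Q (z i) \<le> Q (y i) + lam i * (?d \<bullet> gradient Q (y i)) + (lam i)\<^sup>2 / 2 * (\<beta> + \<beta>\<^sub>2 * D) * (norm ?d)\<^sup>2"
      using cubic_model_descent[OF f_convex grad diam \<beta>2 xt_in w yP[OF i] zP[OF i, unfolded z_def]]
      unfolding z_def Q_eq .
    also have "(lam i)\<^sup>2 / 2 * (\<beta> + \<beta>\<^sub>2 * D) * (norm ?d)\<^sup>2 \<le> (lam i)\<^sup>2 / 2 * (2 * \<beta>') * D\<^sup>2"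
      using diam[OF w] \<beta> \<beta>2 D1 by (intro mult_mono power_mono) (auto simp: beta'_eq)
    also have "\<dots> = (lam i)\<^sup>2 * K" by (simp add: K_def)
    finally show ?thesis by (simp add: h_def inner_diff_left algebra_simps)
  qed

  \<comment> \<open>Induction on the contraction bound\<close>
  have main: "h i \<le> max (K / 2 * (1 - c\<^sub>1) ^ (i - 1)) B" if "1 \<le> i" for i
    using that
  proof (induction i rule: nat_induct_at_least)
    case base
    show ?case using h1 by simp
  next
    case (Suc i)
    define H where "H = K / 2 * (1 - c\<^sub>1) ^ (i - 1)"
    have "(1 - c\<^sub>1) ^ (Suc i - 1) = (1 - c\<^sub>1) * (1 - c\<^sub>1) ^ (i - 1)"
      using Suc(1) by (simp flip: power_Suc)
    then have H_Suc: "K / 2 * (1 - c\<^sub>1) ^ (Suc i - 1) = (1 - c\<^sub>1) * H" by (simp add: H_def)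
    show ?case
    \<comment> \<open>If the new bound already holds at \<open>y i\<close>, monotonicity of the gap
      preserves it.\<close>
    proof (cases "h i \<le> B \<or> h i \<le> (1 - c\<^sub>1) * H")
      case True
      then show ?thesis unfolding H_Suc using h_mono[OF Suc(1)] by auto
    next
      case False
      then have big: "B < h i" "(1 - c\<^sub>1) * H < h i" "h i \<le> H" using Suc(2) by (auto simp: H_def)
      \<comment> \<open>Monotonicity carries \<open>B < h i\<close> back to the first iterate, as
        \<open>c1_small\<close> requires.\<close>
      have "h i \<le> h 1" using Suc(1)
        by (induction i rule: nat_induct_at_least) (use h_mono order_trans in \<open>force+\<close>)
      then have "c\<^sub>1 \<le> 1/16" using big(1) by (intro c1_small) simp
      moreover have "0 \<le> H" using K_pos c1_less by (simp add: H_def)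
      moreover have "(\<gamma> i)\<^sup>2 * K = 2 * c\<^sub>1 * H" using \<gamma>2[OF Suc(1)] by (simp add: H_def)
      moreover have "lam i \<le> \<gamma> i" "0 \<le> lam i" using run_props(5)[OF Suc(1)] by (simp_all add: lam_def)
      \<comment> \<open>By minimality of \<open>q i\<close> the next larger power of 1/2 exceeds the
        step size; when \<open>q i\<close> is 0, the bound by 1 suffices.\<close>
      moreover have "\<gamma> i \<le> 2 * lam i"
      proof (cases "q i")
        case 0
        then show ?thesis using run_props(4)[OF Suc(1)] by (simp add: lam_def)
      next
        case (Suc k)
        then have "\<not> (1/2) ^ k \<le> \<gamma> i" using run_props(6)[OF \<open>1 \<le> i\<close>, of k] by auto
        then show ?thesis using Suc by (simp add: lam_def)
      qed
      ultimately have "h i - lam i * ((wm i - wp i) \<bullet> gradient Q (y i)) + (lam i)\<^sup>2 * K \<le> (1 - c\<^sub>1) * H"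
        using big(2,3) c1_pos K_pos gap[OF Suc(1) big(1)] by (intro step_decrease) auto
      then show ?thesis unfolding H_Suc
        using descent[OF Suc(1)] h_z[OF Suc(1) zP[OF Suc(1)]] by linarith
    qed
  qed
  have K_half: "\<beta>' * D\<^sup>2 / 2 = K / 2" and c1_rate: "\<alpha> / (32 * nstar * \<beta>' * D\<^sup>2) = c\<^sub>1"
    by (simp_all add: K_def c1_eq)
  show ?thesis
    unfolding K_half c1_rate B_def[symmetric]
  proof (intro conjI allI impI)
    fix i :: nat
    assume i: "1 \<le> i"
    show "y i \<in> P" using yP[OF i] .
    show "\<phi> (y i) - \<phi> xstar \<le> ereal (max (K / 2 * (1 - c\<^sub>1) ^ (i - 1)) B)"
      using main[OF i] unfolding phi_P[OF yP[OF i]] phi_P[OF xs] h_def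
      by (simp del: ereal_max)
  qed
qed

end
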